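(* Let $\beta,N>0$ and $M\in\mathbb N$, and let $\alpha$ be the constant in the logarithmic Sobolev inequality for $\nu_{\beta,N,M}$, where $$\alpha\ge\frac12\exp\bigl(-14\beta N^{3/2}(cN\beta^{1/2}+1)-N/2\bigr)$$ for some absolute constant $c>0$. Let $\nu$ be a probability measure on $(\Omega_N,L^2)$ that is absolutely continuous with respect to $\nu_{\beta,N,M}$. Then $\nu_{\beta,N,M}$ satisfies the transportation cost inequality $$W_2^2(\nu,\nu_{\beta,N,M})\le\frac2\alpha\int_{\Omega_N}\log\Bigl(\frac{d\nu}{d\nu_{\beta,N,M}}\Bigr)\,d\nu .$$
   Context: $\mathbb T=\mathbb R/2\pi\mathbb Z$. $\Omega_N=\{f\in L^2(\mathbb T;\mathbb R):\int_{\mathbb T}f^2\,\frac{dx}{2\pi}\le N\}$, with the metric of $L^2$. Functions are identified with their Fourier coefficients via $f(x)=\frac{a_0}{2}+\sum_{j\ge1}(a_j\cos jx+b_j\sin jx)$. The Gibbs measure $\nu_{\beta,N,M}$ is the probability measure on $L^2(\mathbb T;\mathbb R)$ given in terms of $(a_j,b_j)_{j=1}^M$ by $$\nu_{\beta,N,M}(df)=\frac1{Z_{\beta,N,M}}\mathbf I_{\Omega_N}(f)\exp\Bigl(-\beta\int_{\mathbb T}\Bigl(\sum_{j=1}^M a_j\cos jx+b_j\sin jx\Bigr)^3\frac{dx}{2\pi}\Bigr)\prod_{j=1}^M e^{-j(a_j^2+b_j^2)/2}\,\frac{da_j\,db_j}{2\pi j},$$ where $\mathbf I_{\Omega_N}$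 is the indicator function of $\Omega_N$ and $Z_{\beta,N,M}>0$ is the normalising constant. The logarithmic Sobolev inequality with constant $\alpha$ is $$\int F^2\log\Bigl(F^2\Big/\int F^2\,d\nu_{\beta,N,M}\Bigr)\,d\nu_{\beta,N,M}\le\frac2\alpha\int\|\nabla F\|_{L^2}^2\,d\nu_{\beta,N,M}\qquad(F\in C^1(\Omega_N;\mathbb R)),$$ with $\nabla F$ the Fréchet derivative. $W_2(\mu_0,\mu_1)=\inf_\pi\bigl(\iint d(x,y)^2\,\pi(dx\,dy)\bigr)^{1/2}$, the infimum being over probability measures $\pi$ on the product space with marginals $\mu_0$ and $\mu_1$, where $d$ is the $L^2$ distance. *)

theory Defs
  imports "HOL-Probability.Probability"
begin

section \<open>The Hilbert space \<open>L\<^sup>2(\<T>;\<real>)\<close>\<close>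

text \<open>The circle is parametrised by \<open>[0, 2\<pi>)\<close> and carries the normalised measure \<open>dx/2\<pi>\<close>; this
  normalisation is used for the norm, hence for the metric, of \<open>L\<^sup>2\<close>.\<close>

definition circle :: "real measure" where
  "circle = uniform_measure lborel {0..<2 * pi}"

lemma sets_circle [measurable_cong, simp]: "sets circle = sets borel"
  by (simp add: circle_def)

lemma space_circle [simp]: "space circle = UNIV"
  by (simp add: circle_def)

lemma prob_space_circle: "prob_space circle"
  unfolding circle_def
  by (rule prob_space_uniform_measure) (simp_all add: ennreal_eq_0_iff not_le)

interpretation circle: prob_space circle
  by (rule prob_space_circle)

definition square_integrable :: "(real \<Rightarrow> real) \<Rightarrow> bool" where
  "square_integrable f \<longleftrightarrow> f \<in> borel_measurable circle \<and> integrable circle (\<lambda>x. (f x)\<^sup>2)"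

definition L2_rel :: "(real \<Rightarrow> real) \<Rightarrow> (real \<Rightarrow> real) \<Rightarrow> bool" where
  "L2_rel f g \<longleftrightarrow> square_integrable f \<and> square_integrable g \<and> (AE x in circle. f x = g x)"

lemma square_integrable_mult:
  assumes "square_integrable f" "square_integrable g"
  shows "integrable circle (\<lambda>x. f x * g x)"
proof (rule Bochner_Integration.integrable_bound)
  show "integrable circle (\<lambda>x. (f x)\<^sup>2 + (g x)\<^sup>2)"
    using assms by (simp add: square_integrable_def)
  show "(\<lambda>x. f x * g x) \<in> borel_measurable circle"
    using assms unfolding square_integrable_def by (intro borel_measurable_times) auto
  have "\<bar>a * b\<bar> \<le> a\<^sup>2 + b\<^sup>2" for a b :: real
  proof -
    have "2 * (\<bar>a\<bar> * \<bar>b\<bar>) \<le> a\<^sup>2 + b\<^sup>2"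
      using sum_squares_bound[of "\<bar>a\<bar>" "\<bar>b\<bar>"] by simp
    moreover have "0 \<le> \<bar>a\<bar> * \<bar>b\<bar>" by simp
    ultimately show ?thesis unfolding abs_mult by linarith
  qed
  then show "AE x in circle. norm (f x * g x) \<le> norm ((f x)\<^sup>2 + (g x)\<^sup>2)"
    by simp
qed

lemma square_integrable_zero: "square_integrable (\<lambda>x. 0)"
  by (simp add: square_integrable_def)

lemma square_integrable_add:
  assumes "square_integrable f" "square_integrable g"
  shows "square_integrable (\<lambda>x. f x + g x)"
  using assms square_integrable_mult[OF assms]
  by (auto simp: square_integrable_def power2_sum mult.assoc)

lemma square_integrable_scale:
  assumes "square_integrable f"
  shows "square_integrable (\<lambda>x. r * f x)"
  using assms by (auto simp: square_integrable_def power_mult_distrib)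

quotient_type L2T = "real \<Rightarrow> real" / partial: L2_rel
proof (rule part_equivpI)
  show "\<exists>f. L2_rel f f"
    using square_integrable_zero by (auto simp: L2_rel_def)
  show "symp L2_rel"
    by (rule sympI) (auto simp: L2_rel_def)
  show "transp L2_rel"
    by (rule transpI) (auto simp: L2_rel_def)
qed

instantiation L2T :: real_inner
begin

lift_definition zero_L2T :: L2T is "\<lambda>x. 0"
  by (simp add: L2_rel_def square_integrable_zero)

lift_definition plus_L2T :: "L2T \<Rightarrow> L2T \<Rightarrow> L2T" is "\<lambda>f g x. f x + g x"
  by (auto simp: L2_rel_def square_integrable_add)

lift_definition scaleR_L2T :: "real \<Rightarrow> L2T \<Rightarrow> L2T" is "\<lambda>r f x. r * f x"
  by (auto simp: L2_rel_def square_integrable_scale)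

lift_definition uminus_L2T :: "L2T \<Rightarrow> L2T" is "\<lambda>f x. - f x"
  using square_integrable_scale[where r="-1"] by (auto simp: L2_rel_def)

definition minus_L2T :: "L2T \<Rightarrow> L2T \<Rightarrow> L2T" where
  "minus_L2T f g = f + (- g)"

lift_definition inner_L2T :: "L2T \<Rightarrow> L2T \<Rightarrow> real" is "\<lambda>f g. LINT x|circle. f x * g x"
proof -
  fix f f' g g' assume 1: "L2_rel f f'" and 2: "L2_rel g g'"
  show "(LINT x|circle. f x * g x) = (LINT x|circle. f' x * g' x)"
  proof (rule integral_cong_AE)
    show "(\<lambda>x. f x * g x) \<in> borel_measurable circle" "(\<lambda>x. f' x * g' x) \<in> borel_measurable circle"
      using 1 2 by (auto simp: L2_rel_def square_integrable_def)
    show "AE x in circle. f x * g x = f' x * g' x"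
      using 1 2 unfolding L2_rel_def by (auto elim: eventually_elim2)
  qed
qed

definition norm_L2T :: "L2T \<Rightarrow> real" where
  "norm_L2T f = sqrt (inner f f)"

definition sgn_L2T :: "L2T \<Rightarrow> L2T" where
  "sgn_L2T f = inverse (norm f) *\<^sub>R f"

definition dist_L2T :: "L2T \<Rightarrow> L2T \<Rightarrow> real" where
  "dist_L2T f g = norm (f - g)"

definition uniformity_L2T :: "(L2T \<times> L2T) filter" where
  "uniformity_L2T = (INF e\<in>{0<..}. principal {(x, y). dist x y < e})"

definition open_L2T :: "L2T set \<Rightarrow> bool" where
  "open_L2T U = (\<forall>x\<in>U. eventually (\<lambda>(x', y). x' = x \<longrightarrow> y \<in> U) uniformity)"

instance
proof
  fix f g h :: L2T and r s :: real
  show "f + g + h = f + (g + h)"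
    by transfer (auto simp: L2_rel_def square_integrable_add add.assoc)
  show "f + g = g + f"
    by transfer (auto simp: L2_rel_def square_integrable_add add.commute)
  show "0 + f = f"
    by transfer (auto simp: L2_rel_def)
  show "- f + f = 0"
    by transfer (auto simp: L2_rel_def square_integrable_zero)
  show "f - g = f + - g"
    by (rule minus_L2T_def)
  show "r *\<^sub>R (f + g) = r *\<^sub>R f + r *\<^sub>R g"
    by transfer (auto simp: L2_rel_def square_integrable_add square_integrable_scale algebra_simps
        intro!: square_integrable_add square_integrable_scale)
  show "(r + s) *\<^sub>R f = r *\<^sub>R f + s *\<^sub>R f"
    by transfer (auto simp: L2_rel_def algebra_simps
        intro!: square_integrable_add square_integrable_scale)
  show "r *\<^sub>R s *\<^sub>R f = (r * s) *\<^sub>R f"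
    by transfer (auto simp: L2_rel_def mult.assoc intro!: square_integrable_scale)
  show "1 *\<^sub>R f = f"
    by transfer (auto simp: L2_rel_def)
  show "dist f g = norm (f - g)"
    by (rule dist_L2T_def)
  show "sgn f = inverse (norm f) *\<^sub>R f"
    by (rule sgn_L2T_def)
  show "(uniformity :: (L2T \<times> L2T) filter) = (INF e\<in>{0<..}. principal {(x, y). dist x y < e})"
    by (rule uniformity_L2T_def)
  show "open U = (\<forall>x\<in>U. eventually (\<lambda>(x', y). x' = x \<longrightarrow> y \<in> U) uniformity)" for U :: "L2T set"
    by (rule open_L2T_def)
  show "inner f g = inner g f"
    by transfer (simp add: mult.commute)
  show "inner (f + g) h = inner f h + inner g h"
    by transfer (auto simp: L2_rel_def distrib_right square_integrable_mult)
  show "inner (r *\<^sub>R f) g = r * inner f g"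
    by transfer (simp add: mult.assoc)
  show "0 \<le> inner f f"
    by transfer simp
  show "inner f f = 0 \<longleftrightarrow> f = 0"
  proof transfer
    fix f assume f: "L2_rel f f"
    then have "integrable circle (\<lambda>x. f x * f x)"
      by (auto simp: L2_rel_def square_integrable_mult)
    then have "(LINT x|circle. f x * f x) = 0 \<longleftrightarrow> (AE x in circle. f x * f x = 0)"
      by (intro integral_nonneg_eq_0_iff_AE) auto
    then show "(LINT x|circle. f x * f x) = 0 \<longleftrightarrow> L2_rel f (\<lambda>x. 0)"
      using f square_integrable_zero by (auto simp: L2_rel_def)
  qed
  show "norm f = sqrt (inner f f)"
    by (rule norm_L2T_def)
qed

end

definition Omega :: "real \<Rightarrow> L2T set" where
  "Omega N = {f. (norm f)\<^sup>2 \<le> N}"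


section \<open>The Gibbs measure\<close>

text \<open>A coordinate vector \<open>p\<close> stands for the family \<open>p j = (a\<^sub>j, b\<^sub>j)\<close>; only \<open>1 \<le> j \<le> M\<close> is used, so
  \<open>a\<^sub>0\<close> and all modes above \<open>M\<close> vanish.\<close>

definition trig_sum :: "nat \<Rightarrow> (nat \<Rightarrow> real \<times> real) \<Rightarrow> real \<Rightarrow> real" where
  "trig_sum M p x = (\<Sum>j=1..M. fst (p j) * cos (real j * x) + snd (p j) * sin (real j * x))"

lemma square_integrable_trig_sum: "square_integrable (trig_sum M p)"
proof -
  have cont: "continuous_on UNIV (trig_sum M p)"
    unfolding trig_sum_def by (intro continuous_intros)
  then have meas: "trig_sum M p \<in> borel_measurable borel"
    by (rule borel_measurable_continuous_onI)
  define B where "B = (\<Sum>j=1..M. \<bar>fst (p j)\<bar> + \<bar>snd (p j)\<bar>)"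
  have bound: "\<bar>trig_sum M p x\<bar> \<le> B" for x
    unfolding trig_sum_def B_def
  proof (rule order_trans[OF sum_abs], rule sum_mono)
    fix j
    have "\<bar>fst (p j)\<bar> * \<bar>cos (real j * x)\<bar> \<le> \<bar>fst (p j)\<bar>" "\<bar>snd (p j)\<bar> * \<bar>sin (real j * x)\<bar> \<le> \<bar>snd (p j)\<bar>"
      by (simp_all add: mult_left_le)
    then show "\<bar>fst (p j) * cos (real j * x) + snd (p j) * sin (real j * x)\<bar>
        \<le> \<bar>fst (p j)\<bar> + \<bar>snd (p j)\<bar>"
      by (intro order_trans[OF abs_triangle_ineq]) (simp add: abs_mult)
  qed
  have "integrable circle (\<lambda>x. (trig_sum M p x)\<^sup>2)"
  proof (rule circle.integrable_const_bound[where B="B\<^sup>2"])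
    have "(trig_sum M p x)\<^sup>2 \<le> B\<^sup>2" for x
      using power_mono[OF bound abs_ge_zero, of x 2] by simp
    then show "AE x in circle. norm ((trig_sum M p x)\<^sup>2) \<le> B\<^sup>2"
      by simp
    show "(\<lambda>x. (trig_sum M p x)\<^sup>2) \<in> borel_measurable circle"
      using meas by simp
  qed
  with meas show ?thesis
    by (simp add: square_integrable_def)
qed

lift_definition trig_L2 :: "nat \<Rightarrow> (nat \<Rightarrow> real \<times> real) \<Rightarrow> L2T" is trig_sum
  by (simp add: L2_rel_def square_integrable_trig_sum)

definition coords :: "nat \<Rightarrow> (nat \<Rightarrow> real \<times> real) measure" where
  "coords M = (\<Pi>\<^sub>M j\<in>{1..M}. lborel)"

definition gibbs_weight :: "real \<Rightarrow> real \<Rightarrow> nat \<Rightarrow> (nat \<Rightarrow> real \<times> real) \<Rightarrow> real" where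
  "gibbs_weight \<beta> N M p =
     indicator (Omega N) (trig_L2 M p)
     * exp (- \<beta> * (LINT x|circle. (trig_sum M p x) ^ 3))
     * (\<Prod>j=1..M. exp (- (real j * ((fst (p j))\<^sup>2 + (snd (p j))\<^sup>2) / 2)) / (2 * pi * real j))"

definition gibbs_Z :: "real \<Rightarrow> real \<Rightarrow> nat \<Rightarrow> real" where
  "gibbs_Z \<beta> N M = (LINT p|coords M. gibbs_weight \<beta> N M p)"

definition gibbs :: "real \<Rightarrow> real \<Rightarrow> nat \<Rightarrow> L2T measure" where
  "gibbs \<beta> N M =
     distr (density (coords M) (\<lambda>p. ennreal (gibbs_weight \<beta> N M p / gibbs_Z \<beta> N M)))
       borel (trig_L2 M)"


section \<open>The logarithmic Sobolev inequality\<close>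

text \<open>The relation \<open>F \<in> C\<^sup>1(\<Omega>\<^sub>N)\<close> with Frechet derivative \<open>F'\<close>, the derivative being taken relative to
  the closed ball \<open>\<Omega>\<^sub>N\<close> (for \<open>N > 0\<close> it is then unique). The gradient \<open>\<nabla>F(f) \<in> L\<^sup>2\<close> is the Riesz
  representative of the functional \<open>F' f\<close>, so \<open>\<parallel>\<nabla>F(f)\<parallel>\<close> is the operator norm of \<open>F' f\<close>.\<close>

definition C1_on_Omega :: "real \<Rightarrow> (L2T \<Rightarrow> real) \<Rightarrow> (L2T \<Rightarrow> (L2T \<Rightarrow>\<^sub>L real)) \<Rightarrow> bool" where
  "C1_on_Omega N F F' \<longleftrightarrow>
     (\<forall>f\<in>Omega N. (F has_derivative blinfun_apply (F' f)) (at f within Omega N))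
     \<and> continuous_on (Omega N) F'"

text \<open>The convention \<open>0 log 0 = 0\<close> is provided by \<open>ln 0 = 0\<close>.\<close>

definition log_sobolev :: "real \<Rightarrow> real \<Rightarrow> nat \<Rightarrow> real \<Rightarrow> bool" where
  "log_sobolev \<beta> N M \<alpha> \<longleftrightarrow>
     (\<forall>F F'. C1_on_Omega N F F' \<longrightarrow>
        (LINT f:Omega N|gibbs \<beta> N M.
            (F f)\<^sup>2 * ln ((F f)\<^sup>2 / (LINT g:Omega N|gibbs \<beta> N M. (F g)\<^sup>2)))
        \<le> 2 / \<alpha> * (LINT f:Omega N|gibbs \<beta> N M. (norm (F' f))\<^sup>2))"


section \<open>Transportation cost and relative entropy\<close>

definition couplings :: "'a::metric_space measure \<Rightarrow> 'a measure \<Rightarrow> ('a \<times> 'a) measure set" where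
  "couplings \<mu>0 \<mu>1 =
     {\<pi>. prob_space \<pi> \<and> sets \<pi> = sets (borel \<Otimes>\<^sub>M borel)
         \<and> distr \<pi> borel fst = \<mu>0 \<and> distr \<pi> borel snd = \<mu>1}"

definition ennreal_sqrt :: "ennreal \<Rightarrow> ennreal" where
  "ennreal_sqrt x = (if x = \<infinity> then \<infinity> else ennreal (sqrt (enn2real x)))"

definition W2 :: "'a::metric_space measure \<Rightarrow> 'a measure \<Rightarrow> ennreal" where
  "W2 \<mu>0 \<mu>1 =
     (INF \<pi>\<in>couplings \<mu>0 \<mu>1. ennreal_sqrt (\<integral>\<^sup>+z. ennreal ((dist (fst z) (snd z))\<^sup>2) \<partial>\<pi>))"

text \<open>The relative entropy may be \<open>+\<infinity>\<close>, whereas the Bochner integral of a non-integrable function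
  is \<open>0\<close>; hence the integral of \<open>log (d\<nu>/d\<mu>)\<close> over \<open>A\<close> is formed in the extended reals. Its negative
  part always has finite integral when \<open>\<nu>\<close> and \<open>\<mu>\<close> are probability measures with \<open>\<nu> \<ll> \<mu>\<close>.\<close>

definition extended_integral :: "'a measure \<Rightarrow> 'a set \<Rightarrow> ('a \<Rightarrow> real) \<Rightarrow> ereal" where
  "extended_integral M A h =
     enn2ereal (\<integral>\<^sup>+x\<in>A. ennreal (h x) \<partial>M) - enn2ereal (\<integral>\<^sup>+x\<in>A. ennreal (- h x) \<partial>M)"

end

theory Submission
  imports Defs
begin

text \<open>Hopf--Lax functions \<open>v\<^sub>t(x)\<close> satisfy \<open>\<partial>v/\<partial>t + |\<nabla>v|\<^sup>2 / 2 \<le> 0\<close>, and the logarithmic Sobolev inequality applied to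
  \<open>F\<^sup>2 = exp (\<alpha> t v\<^sub>t)\<close> then says that \<open>ln (\<integral> exp (\<alpha> t v\<^sub>t) d\<mu>) / (\<alpha> t)\<close> decreases in \<open>t\<close> (Bobkov, Gentil and
  Ledoux). Comparing \<open>t = 1\<close> with \<open>t \<longrightarrow> 0\<close> gives \<open>ln (\<integral> exp (\<alpha> v\<^sub>1) d\<mu>) / \<alpha> \<le> \<integral> v\<^sub>0 d\<mu>\<close>, hence by the entropy
  inequality \<open>\<integral> v\<^sub>1 d\<nu> - \<integral> v\<^sub>0 d\<mu> \<le> (1 / \<alpha>) \<integral> ln (d\<nu>/d\<mu>) d\<nu>\<close>, and the supremum of the left side over
  \<open>v\<^sub>0\<close> is \<open>W\<^sub>2\<^sup>2 / 2\<close> by duality. The Gibbs measure lives on a compact set, which can be cut into finitely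
  many small cells; so duality is needed only between measures on finite sets, and the Hopf--Lax infimum
  is over a finite set and may be replaced by a smooth soft minimum.\<close>

section \<open>Duality for finite transport problems\<close>

text \<open>A single \<open>\<epsilon>\<close> controls every approximation: cell size, duality gap,
  smoothing error and initial time. The limit t = 0 is never taken: \<open>\<phi>\<close> is given
  at cell centres only, and |x - y j|^2 / (2 t) blows up at any x other than y j. The comparison
  instead starts at a time s > 0. There the centre of the cell of x is a candidate of cost at most
  \<epsilon>^2 / (2 s), and a second order expansion of the exponential costs a multiple of s times
  the squared bound on \<open>\<phi>\<close>; s = \<epsilon> makes both errors of order \<epsilon>.
  This needs a bound on \<open>\<phi>\<close> that does not depend on the partition, so the dual
  potentials are normalised to be bounded by the largest cost. The soft minimum suits the
  logarithmic Sobolev inequality because it is C^1 in x, and it lies below the true minimum by at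
  most \<eta> ln |J|, which a low temperature makes negligible. A plan between cells becomes a
  coupling through a density with respect to the product measure, so no disintegration
  enters.\<close>

text \<open>Tychonoff's theorem for the product topology on a function type; it serves both the
  polytope of plans and the cube of Fourier coefficients.\<close>

lemma compact_Pi_UNIV:
  fixes S :: "'i \<Rightarrow> 'b::topological_space set"
  assumes "\<And>i. compact (S i)"
  shows "compact {w. \<forall>i. w i \<in> S i}"
proof -
  have "compactin (product_topology (\<lambda>i. euclidean) UNIV) (PiE UNIV S)"
    using assms by (simp add: compactin_PiE)
  moreover have "PiE UNIV S = {w. \<forall>i. w i \<in> S i}"
    by (auto simp: PiE_def Pi_def extensional_def)
  ultimately show ?thesis
    by (simp add: euclidean_product_topology)
qed

text \<open>The log-barrier \<open>e \<Sum> ln w\<close> keeps the optimal plan in the interior of the transport polytope,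
  so its first variation vanishes in every direction with zero marginals; this makes
  \<open>c - e / w\<close> a sum \<open>g x + f y\<close>, with duality gap \<open>e |A| |B|\<close>.\<close>

lemma finite_transport_barrier:
  fixes a :: "'a \<Rightarrow> real" and b :: "'b \<Rightarrow> real" and c :: "'a \<Rightarrow> 'b \<Rightarrow> real"
  assumes fin: "finite A" "finite B" and pos: "\<And>x. x \<in> A \<Longrightarrow> a x > 0" "\<And>y. y \<in> B \<Longrightarrow> b y > 0"
    and one: "sum a A = 1" "sum b B = 1" and e: "e > 0"
  obtains w :: "'a \<times> 'b \<Rightarrow> real" where "\<And>p. p \<in> A \<times> B \<Longrightarrow> w p > 0"
    "\<And>x. x \<in> A \<Longrightarrow> (\<Sum>y\<in>B. w (x, y)) = a x" "\<And>y. y \<in> B \<Longrightarrow> (\<Sum>x\<in>A. w (x, y)) = b y"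
    "\<And>s. \<lbrakk>\<And>x. x \<in> A \<Longrightarrow> (\<Sum>y\<in>B. s (x, y)) = 0; \<And>y. y \<in> B \<Longrightarrow> (\<Sum>x\<in>A. s (x, y)) = 0\<rbrakk>
      \<Longrightarrow> (\<Sum>p\<in>A\<times>B. s p * (c (fst p) (snd p) - e / w p)) = 0"
proof -
  define P where "P = A \<times> B"
  have finP: "finite P" using fin by (simp add: P_def)
  \<comment> \<open>Entries off \<open>P\<close> are pinned to 0: plans are total functions, and
    free entries would destroy compactness.\<close>
  define box where "box = {w :: 'a \<times> 'b \<Rightarrow> real. \<forall>p. w p \<in> (if p \<in> P then {0..1} else {0})}"
  define S where "S = box \<inter> (\<Inter>x\<in>A. {w. (\<Sum>y\<in>B. w (x, y)) = a x}) \<inter> (\<Inter>y\<in>B. {w. (\<Sum>x\<in>A. w (x, y)) = b y})"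
  \<comment> \<open>This is exp (- (cost - e \<Sum> ln w) / e). Exponentiating the barrier
    functional makes it continuous up to the boundary, with value 0 wherever an entry of
    \<open>w\<close> vanishes.\<close>
  define J where "J w = exp (- (\<Sum>p\<in>P. w p * c (fst p) (snd p)) / e) * (\<Prod>p\<in>P. w p)" for w :: "'a \<times> 'b \<Rightarrow> real"
  have coord: "continuous_on UNIV (\<lambda>w :: 'a \<times> 'b \<Rightarrow> real. w p)" for p
    by simp
  have "compact box"
    unfolding box_def by (rule compact_Pi_UNIV) auto
  moreover have "closed (\<Inter>x\<in>A. {w :: 'a \<times> 'b \<Rightarrow> real. (\<Sum>y\<in>B. w (x, y)) = a x})"
    by (intro closed_INT ballI closed_Collect_eq continuous_on_sum coord continuous_on_const)
  moreover have "closed (\<Inter>y\<in>B. {w :: 'a \<times> 'b \<Rightarrow> real. (\<Sum>x\<in>A. w (x, y)) = b y})"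
    by (intro closed_INT ballI closed_Collect_eq continuous_on_sum coord continuous_on_const)
  ultimately have compS: "compact S"
    unfolding S_def by (intro compact_Int_closed)
  have in_S: "w \<in> S" if nn: "\<And>p. p \<in> P \<Longrightarrow> w p \<ge> 0" and "\<And>p. p \<notin> P \<Longrightarrow> w p = 0"
      and row: "\<And>x. x \<in> A \<Longrightarrow> (\<Sum>y\<in>B. w (x, y)) = a x" and "\<And>y. y \<in> B \<Longrightarrow> (\<Sum>x\<in>A. w (x, y)) = b y" for w
  proof -
    have "w p \<le> 1" if p: "p \<in> P" for p
    proof -
      obtain x y where [simp]: "p = (x, y)" and xy: "x \<in> A" "y \<in> B" using p by (auto simp: P_def)
      have "w (x, y) \<le> (\<Sum>y\<in>B. w (x, y))"
        using xy fin nn by (intro member_le_sum) (auto simp: P_def)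
      also have "\<dots> = a x" using row xy by simp
      also have "\<dots> \<le> sum a A" using xy fin pos by (intro member_le_sum) (auto intro: less_imp_le)
      finally show ?thesis using one by simp
    qed
    then show ?thesis using that by (auto simp: S_def box_def)
  qed
  \<comment> \<open>The product plan is feasible and strictly positive, so the maximum of
    \<open>J\<close> is positive and a maximiser has no zero entry on \<open>P\<close>.\<close>
  define w0 where "w0 p = (if p \<in> P then a (fst p) * b (snd p) else 0)" for p
  have w0S: "w0 \<in> S"
  proof (rule in_S)
    show "(\<Sum>y\<in>B. w0 (x, y)) = a x" if "x \<in> A" for x
    proof -
      have "(\<Sum>y\<in>B. w0 (x, y)) = (\<Sum>y\<in>B. a x * b y)"
        using that by (intro sum.cong) (auto simp: w0_def P_def)
      then show ?thesis by (simp add: sum_distrib_left[symmetric] one)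
    qed
    show "(\<Sum>x\<in>A. w0 (x, y)) = b y" if "y \<in> B" for y
    proof -
      have "(\<Sum>x\<in>A. w0 (x, y)) = (\<Sum>x\<in>A. a x * b y)"
        using that by (intro sum.cong) (auto simp: w0_def P_def)
      then show ?thesis by (simp add: sum_distrib_right[symmetric] one)
    qed
  qed (use pos in \<open>auto simp: w0_def P_def intro: less_imp_le mult_pos_pos\<close>)
  have "continuous_on S J"
    unfolding J_def
    by (intro continuous_intros continuous_on_subset[OF coord]) (use e in auto)
  then obtain w where w: "w \<in> S" and max: "\<And>u. u \<in> S \<Longrightarrow> J u \<le> J w"
    using continuous_attains_sup[OF compS _ \<open>continuous_on S J\<close>] w0S by blast
  have "0 < J w0"
    unfolding J_def by (intro mult_pos_pos prod_pos) (auto simp: w0_def P_def pos)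
  then have Jw: "0 < J w" using max[OF w0S] by linarith
  have wbox: "w p \<in> (if p \<in> P then {0..1} else {0})" for p
    using w unfolding S_def box_def by blast
  have wnn: "0 \<le> w p" if "p \<in> P" for p using wbox[of p] that by simp
  have wpos: "0 < w p" if "p \<in> P" for p
  proof (rule ccontr)
    assume "\<not> 0 < w p"
    then have "w p = 0" using wnn[OF that] by simp
    then have "(\<Prod>p\<in>P. w p) = 0" using finP that by auto
    then show False using Jw by (simp add: J_def)
  qed
  have wout: "w p = 0" if "p \<notin> P" for p
    using wbox[of p] that by simp
  have wm: "\<And>x. x \<in> A \<Longrightarrow> (\<Sum>y\<in>B. w (x, y)) = a x" "\<And>y. y \<in> B \<Longrightarrow> (\<Sum>x\<in>A. w (x, y)) = b y"
    using w by (auto simp: S_def)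
  have crit: "(\<Sum>p\<in>P. s p * (c (fst p) (snd p) - e / w p)) = 0"
    if s: "\<And>x. x \<in> A \<Longrightarrow> (\<Sum>y\<in>B. s (x, y)) = 0" "\<And>y. y \<in> B \<Longrightarrow> (\<Sum>x\<in>A. s (x, y)) = 0" for s
  proof -
    define u where "u h p = (if p \<in> P then w p + h * s p else 0)" for h p
    have "\<forall>\<^sub>F h in at 0. \<forall>p\<in>P. 0 < w p + h * s p"
    proof (rule eventually_ball_finite[OF finP], rule ballI)
      fix p assume "p \<in> P"
      have "((\<lambda>h. w p + h * s p) \<longlongrightarrow> w p + 0 * s p) (at 0)" by (intro tendsto_intros)
      then show "\<forall>\<^sub>F h in at 0. 0 < w p + h * s p"
        using wpos[OF \<open>p \<in> P\<close>] by (simp add: order_tendstoD)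
    qed
    then obtain d where d: "d > 0" "\<And>h p. \<bar>h\<bar> < d \<Longrightarrow> p \<in> P \<Longrightarrow> 0 < w p + h * s p"
      unfolding eventually_at using wpos by (metis add.right_neutral dist_real_def diff_zero mult_zero_left UNIV_I)
    \<comment> \<open>\<open>L\<close> is the logarithm of \<open>J\<close> along the line through
      \<open>w\<close> in direction \<open>s\<close>. Its derivative at the maximum h = 0 is the sum
      in question divided by - e.\<close>
    define L where "L h = - (\<Sum>p\<in>P. (w p + h * s p) * c (fst p) (snd p)) / e + (\<Sum>p\<in>P. ln (w p + h * s p))" for h
    have uS: "u h \<in> S" if "\<bar>h\<bar> < d" for h
    proof (rule in_S)
      show "0 \<le> u h p" if "p \<in> P" for p using d(2)[OF \<open>\<bar>h\<bar> < d\<close> that] that by (simp add: u_def)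
      show "(\<Sum>y\<in>B. u h (x, y)) = a x" if "x \<in> A" for x
      proof -
        have "(\<Sum>y\<in>B. u h (x, y)) = (\<Sum>y\<in>B. w (x, y) + h * s (x, y))"
          using that by (intro sum.cong) (auto simp: u_def P_def)
        then show ?thesis using that s wm by (simp add: sum.distrib sum_distrib_left[symmetric])
      qed
      show "(\<Sum>x\<in>A. u h (x, y)) = b y" if "y \<in> B" for y
      proof -
        have "(\<Sum>x\<in>A. u h (x, y)) = (\<Sum>x\<in>A. w (x, y) + h * s (x, y))"
          using that by (intro sum.cong) (auto simp: u_def P_def)
        then show ?thesis using that s wm by (simp add: sum.distrib sum_distrib_left[symmetric])
      qed
    qed (auto simp: u_def)
    have JL: "J (u h) = exp (L h)" if "\<bar>h\<bar> < d" for h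
    proof -
      have "(\<Prod>p\<in>P. u h p) = (\<Prod>p\<in>P. exp (ln (w p + h * s p)))"
        using d(2)[OF that] by (intro prod.cong) (auto simp: u_def)
      moreover have "(\<Sum>p\<in>P. u h p * c (fst p) (snd p)) = (\<Sum>p\<in>P. (w p + h * s p) * c (fst p) (snd p))"
        by (intro sum.cong) (auto simp: u_def)
      ultimately show ?thesis by (simp only: J_def L_def exp_add exp_sum[OF finP])
    qed
    have u0: "u 0 = w" using wout by (auto simp: u_def fun_eq_iff)
    have Lmax: "\<forall>h. \<bar>0 - h\<bar> < d \<longrightarrow> L h \<le> L 0"
    proof (intro allI impI)
      fix h :: real assume "\<bar>0 - h\<bar> < d"
      then have h: "\<bar>h\<bar> < d" by simp
      have "J (u h) \<le> J (u 0)" using max[OF uS[OF h]] by (simp add: u0)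
      then show "L h \<le> L 0" using JL[OF h] JL[of 0] d(1) by simp
    qed
    have "(L has_real_derivative - (\<Sum>p\<in>P. s p * c (fst p) (snd p)) / e + (\<Sum>p\<in>P. s p / w p)) (at 0)"
      unfolding L_def
      by (auto intro!: derivative_eq_intros simp: wpos e sum_distrib_left less_imp_neq[OF e, symmetric])
    from DERIV_local_max[OF this d(1) Lmax]
    have "(\<Sum>p\<in>P. s p * c (fst p) (snd p)) = e * (\<Sum>p\<in>P. s p / w p)"
      using e by (simp add: field_simps)
    then show ?thesis
      by (simp add: right_diff_distrib sum_subtractf sum_distrib_left mult.commute)
  qed
  show thesis
    by (rule that[of w]) (use wpos wm crit in \<open>auto simp: P_def\<close>)
qed

text \<open>Let S be the cost minus barrier strength over \<open>w\<close>. It annihilates all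
  directions with zero marginals, in particular products of differences of point masses; this gives
  S x y - S x y0 - S x0 y + S x0 y0 = 0, so S splits into a function of x plus one of y. The two are
  dual feasible because c - S is positive, and integrating S against the plan gives the dual
  value.\<close>

lemma finite_transport_duality:
  fixes a :: "'a \<Rightarrow> real" and b :: "'b \<Rightarrow> real" and c :: "'a \<Rightarrow> 'b \<Rightarrow> real"
  assumes fin: "finite A" "finite B" and pos: "\<And>x. x \<in> A \<Longrightarrow> a x > 0" "\<And>y. y \<in> B \<Longrightarrow> b y > 0"
    and one: "sum a A = 1" "sum b B = 1" and e: "e > 0"
  obtains w :: "'a \<Rightarrow> 'b \<Rightarrow> real" and g f where
    "\<And>x y. x \<in> A \<Longrightarrow> y \<in> B \<Longrightarrow> w x y \<ge> 0"
    "\<And>x. x \<in> A \<Longrightarrow> (\<Sum>y\<in>B. w x y) = a x" "\<And>y. y \<in> B \<Longrightarrow> (\<Sum>x\<in>A. w x y) = b y"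
    "\<And>x y. x \<in> A \<Longrightarrow> y \<in> B \<Longrightarrow> g x + f y \<le> c x y"
    "(\<Sum>x\<in>A. \<Sum>y\<in>B. w x y * c x y) \<le> (\<Sum>x\<in>A. g x * a x) + (\<Sum>y\<in>B. f y * b y) + e"
proof -
  have ne: "A \<noteq> {}" "B \<noteq> {}" using one by auto
  \<comment> \<open>On each of the \<open>k\<close> pairs w (c - S) equals the barrier strength, so
    strength e / k makes the total gap \<open>e\<close>.\<close>
  define k where "k = real (card A) * real (card B)"
  have k: "k > 0" using ne fin by (simp add: k_def card_gt_0_iff)
  have ek: "e / k > 0" using e k by simp
  obtain w :: "'a \<times> 'b \<Rightarrow> real" where w: "\<And>p. p \<in> A \<times> B \<Longrightarrow> w p > 0"
    "\<And>x. x \<in> A \<Longrightarrow> (\<Sum>y\<in>B. w (x, y)) = a x" "\<And>y. y \<in> B \<Longrightarrow> (\<Sum>x\<in>A. w (x, y)) = b y"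
    and crit: "\<And>s. \<lbrakk>\<And>x. x \<in> A \<Longrightarrow> (\<Sum>y\<in>B. s (x, y)) = 0; \<And>y. y \<in> B \<Longrightarrow> (\<Sum>x\<in>A. s (x, y)) = 0\<rbrakk>
      \<Longrightarrow> (\<Sum>p\<in>A\<times>B. s p * (c (fst p) (snd p) - (e / k) / w p)) = 0"
    using finite_transport_barrier[OF fin pos one ek, where c=c] by (smt (verit, best))
  define S where "S x y = c x y - (e / k) / w (x, y)" for x y
  obtain x0 y0 where 0: "x0 \<in> A" "y0 \<in> B" using ne by auto
  have split: "S x y = S x y0 + (S x0 y - S x0 y0)" if xy: "x \<in> A" "y \<in> B" for x y
  proof -
    define \<alpha> where "\<alpha> z = (if z = x then 1 else 0) - (if z = x0 then 1 else (0::real))" for z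
    define \<gamma> where "\<gamma> z = (if z = y then 1 else 0) - (if z = y0 then 1 else (0::real))" for z
    have "sum \<alpha> A = 0" using xy 0 fin by (simp add: \<alpha>_def sum_subtractf)
    moreover have "sum \<gamma> B = 0" using xy 0 fin by (simp add: \<gamma>_def sum_subtractf)
    ultimately have "(\<Sum>p\<in>A\<times>B. (\<alpha> (fst p) * \<gamma> (snd p)) * (c (fst p) (snd p) - (e / k) / w p)) = 0"
      by (intro crit) (simp_all add: sum_distrib_left[symmetric] sum_distrib_right[symmetric])
    then have "(\<Sum>i\<in>A. \<alpha> i * (\<Sum>j\<in>B. \<gamma> j * S i j)) = 0"
      by (simp add: sum.cartesian_product S_def case_prod_unfold sum_distrib_left mult.assoc)
    moreover have "(\<Sum>j\<in>B. \<gamma> j * S i j) = S i y - S i y0" for i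
      using xy 0 fin by (simp add: \<gamma>_def left_diff_distrib sum_subtractf if_distrib[of "\<lambda>u. u * _"] cong: if_cong)
    moreover have "(\<Sum>i\<in>A. \<alpha> i * (S i y - S i y0)) = (S x y - S x y0) - (S x0 y - S x0 y0)"
      using xy 0 fin by (simp add: \<alpha>_def left_diff_distrib sum_subtractf if_distrib[of "\<lambda>u. u * _"] cong: if_cong)
    ultimately show ?thesis by simp
  qed
  have wc: "(\<Sum>x\<in>A. \<Sum>y\<in>B. w (x, y) * c x y) = (\<Sum>x\<in>A. \<Sum>y\<in>B. w (x, y) * S x y) + e"
  proof -
    have "(\<Sum>x\<in>A. \<Sum>y\<in>B. w (x, y) * c x y) = (\<Sum>x\<in>A. \<Sum>y\<in>B. w (x, y) * S x y + e / k)"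
    proof (intro sum.cong refl)
      fix x y assume "x \<in> A" "y \<in> B"
      then have "w (x, y) \<noteq> 0" using w(1)[of "(x, y)"] by simp
      then show "w (x, y) * c x y = w (x, y) * S x y + e / k"
        by (simp add: S_def right_diff_distrib)
    qed
    also have "\<dots> = (\<Sum>x\<in>A. \<Sum>y\<in>B. w (x, y) * S x y) + k * (e / k)"
      by (simp add: sum.distrib k_def)
    finally show ?thesis using k by simp
  qed
  have "(\<Sum>x\<in>A. \<Sum>y\<in>B. w (x, y) * S x y)
      = (\<Sum>x\<in>A. \<Sum>y\<in>B. w (x, y) * S x y0) + (\<Sum>x\<in>A. \<Sum>y\<in>B. w (x, y) * (S x0 y - S x0 y0))"
    by (simp only: sum.distrib[symmetric] distrib_left[symmetric])
      (intro sum.cong refl, metis split)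
  also have "(\<Sum>x\<in>A. \<Sum>y\<in>B. w (x, y) * (S x0 y - S x0 y0)) = (\<Sum>y\<in>B. \<Sum>x\<in>A. w (x, y) * (S x0 y - S x0 y0))"
    by (rule sum.swap)
  finally have wS: "(\<Sum>x\<in>A. \<Sum>y\<in>B. w (x, y) * S x y)
      = (\<Sum>x\<in>A. S x y0 * a x) + (\<Sum>y\<in>B. (S x0 y - S x0 y0) * b y)"
    by (simp add: sum_distrib_right[symmetric] w mult.commute[of _ "a _"] mult.commute[of _ "b _"])
  show thesis
  proof (rule that[of "\<lambda>x y. w (x, y)" "\<lambda>x. S x y0" "\<lambda>y. S x0 y - S x0 y0"])
    show "S x y0 + (S x0 y - S x0 y0) \<le> c x y" if "x \<in> A" "y \<in> B" for x y
    proof -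
      have "(e / k) / w (x, y) > 0" using w(1)[of "(x, y)"] that ek divide_pos_pos by blast
      then show ?thesis using split[OF that] unfolding S_def[of x y] by linarith
    qed
    show "(\<Sum>x\<in>A. \<Sum>y\<in>B. w (x, y) * c x y)
      \<le> (\<Sum>x\<in>A. S x y0 * a x) + (\<Sum>y\<in>B. (S x0 y - S x0 y0) * b y) + e"
      using wc wS by simp
  qed (use w in \<open>auto intro: less_imp_le\<close>)
qed

text \<open>Replacing f by the c-transform of g, the largest potential admissible with g, can only
  raise the dual value, and its oscillation is at most C because 0 \<le> c \<le> C. A constant moved
  from one potential to the other leaves the value unchanged, as both masses are 1. The sign of f is
  reversed so that the constraint reads g x \<le> f y + c x y, the shape of a Hopf--Lax
  infimum.\<close>

lemma finite_transport_duality_bounded: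
  fixes a :: "'a \<Rightarrow> real" and b :: "'b \<Rightarrow> real" and c :: "'a \<Rightarrow> 'b \<Rightarrow> real"
  assumes fin: "finite A" "finite B" and pos: "\<And>x. x \<in> A \<Longrightarrow> a x > 0" "\<And>y. y \<in> B \<Longrightarrow> b y > 0"
    and one: "sum a A = 1" "sum b B = 1" and e: "e > 0"
    and c: "\<And>x y. x \<in> A \<Longrightarrow> y \<in> B \<Longrightarrow> 0 \<le> c x y \<and> c x y \<le> C"
  obtains w :: "'a \<Rightarrow> 'b \<Rightarrow> real" and g f where
    "\<And>x y. x \<in> A \<Longrightarrow> y \<in> B \<Longrightarrow> w x y \<ge> 0"
    "\<And>x. x \<in> A \<Longrightarrow> (\<Sum>y\<in>B. w x y) = a x" "\<And>y. y \<in> B \<Longrightarrow> (\<Sum>x\<in>A. w x y) = b y"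
    "\<And>x y. x \<in> A \<Longrightarrow> y \<in> B \<Longrightarrow> g x - f y \<le> c x y" "\<And>y. y \<in> B \<Longrightarrow> \<bar>f y\<bar> \<le> C"
    "(\<Sum>x\<in>A. \<Sum>y\<in>B. w x y * c x y) \<le> (\<Sum>x\<in>A. g x * a x) - (\<Sum>y\<in>B. f y * b y) + e"
proof -
  obtain w :: "'a \<Rightarrow> 'b \<Rightarrow> real" and g f where w: "\<And>x y. x \<in> A \<Longrightarrow> y \<in> B \<Longrightarrow> w x y \<ge> 0"
    "\<And>x. x \<in> A \<Longrightarrow> (\<Sum>y\<in>B. w x y) = a x" "\<And>y. y \<in> B \<Longrightarrow> (\<Sum>x\<in>A. w x y) = b y"
    and gf: "\<And>x y. x \<in> A \<Longrightarrow> y \<in> B \<Longrightarrow> g x + f y \<le> c x y"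
    and le: "(\<Sum>x\<in>A. \<Sum>y\<in>B. w x y * c x y) \<le> (\<Sum>x\<in>A. g x * a x) + (\<Sum>y\<in>B. f y * b y) + e"
    by (rule finite_transport_duality[OF fin pos one e, where c=c]) blast+
  have ne: "A \<noteq> {}" "B \<noteq> {}" using one by auto
  define f' where "f' y = Min ((\<lambda>x. c x y - g x) ` A)" for y
  have f'_le: "f' y \<le> c x y - g x" if "x \<in> A" for x y
    unfolding f'_def using fin that by (intro Min_le) auto
  have f'_in: "\<exists>x\<in>A. f' y = c x y - g x" for y
  proof -
    have "f' y \<in> (\<lambda>x. c x y - g x) ` A"
      unfolding f'_def using fin ne by (intro Min_in) auto
    then show ?thesis by blast
  qed
  have ff': "f y \<le> f' y" if "y \<in> B" for y
    using f'_in[of y] gf that by (metis add.commute le_diff_eq)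
  have osc: "f' y \<le> f' z + C" if yz: "y \<in> B" "z \<in> B" for y z
  proof -
    obtain x where x: "x \<in> A" "f' z = c x z - g x" using f'_in by blast
    show ?thesis using x f'_le[OF x(1), of y] c[OF x(1) yz(1)] c[OF x(1) yz(2)] by linarith
  qed
  obtain y0 where y0: "y0 \<in> B" using ne by auto
  have sg: "(\<Sum>x\<in>A. (g x + f' y0) * a x) = (\<Sum>x\<in>A. g x * a x) + f' y0"
    by (simp add: distrib_right sum.distrib sum_distrib_left[symmetric] one)
  have sf: "(\<Sum>y\<in>B. (f' y0 - f' y) * b y) = f' y0 - (\<Sum>y\<in>B. f' y * b y)"
    by (simp add: left_diff_distrib sum_subtractf sum_distrib_left[symmetric] one)
  have "(\<Sum>y\<in>B. f y * b y) \<le> (\<Sum>y\<in>B. f' y * b y)"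
    by (intro sum_mono mult_right_mono ff') (use pos in \<open>auto intro: less_imp_le\<close>)
  with le sg sf show thesis
    by (intro that[of w "\<lambda>x. g x + f' y0" "\<lambda>y. f' y0 - f' y"])
      (use w f'_le osc[OF y0] osc[OF _ y0] in \<open>auto simp: abs_le_iff algebra_simps\<close>)
qed

section \<open>Logarithmic Sobolev inequality and Hamilton--Jacobi subsolutions\<close>

text \<open>Dominated convergence along sequences: the mean value inequality bounds all difference
  quotients by \<open>C\<close>. For this the exceptional null set must be the same for all
  t.\<close>

lemma (in prob_space) has_real_derivative_expectation:
  fixes f f' :: "real \<Rightarrow> 'a \<Rightarrow> real"
  assumes t0: "t0 \<in> {l<..<u}"
    and meas: "\<And>t. t \<in> {l<..<u} \<Longrightarrow> integrable M (f t)" "f' t0 \<in> borel_measurable M"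
    and deriv: "AE x in M. \<forall>t\<in>{l<..<u}. ((\<lambda>t. f t x) has_real_derivative f' t x) (at t) \<and> \<bar>f' t x\<bar> \<le> C"
  shows "((\<lambda>t. expectation (f t)) has_real_derivative expectation (f' t0)) (at t0)"
proof -
  let ?I = "{l<..<u}"
  have "((\<lambda>t. (expectation (f t) - expectation (f t0)) / (t - t0)) \<longlongrightarrow> expectation (f' t0)) (at t0 within ?I)"
    unfolding tendsto_at_iff_sequentially
  proof (intro allI impI)
    fix X assume X: "\<forall>i. X i \<in> ?I - {t0}" and lim: "X \<longlonglongrightarrow> t0"
    have "(\<lambda>i. expectation (\<lambda>x. (f (X i) x - f t0 x) / (X i - t0))) \<longlonglongrightarrow> expectation (f' t0)"
    proof (rule integral_dominated_convergence[where w="\<lambda>_. C"])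
      show "AE x in M. (\<lambda>i. (f (X i) x - f t0 x) / (X i - t0)) \<longlonglongrightarrow> f' t0 x"
        using deriv
      proof eventually_elim
        case (elim x)
        then have "((\<lambda>t. (f t x - f t0 x) / (t - t0)) \<longlongrightarrow> f' t0 x) (at t0)"
          using t0 by (auto simp: has_field_derivative_iff)
        then show ?case
          unfolding tendsto_at_iff_sequentially comp_def using X lim by auto
      qed
      show "AE x in M. norm ((f (X i) x - f t0 x) / (X i - t0)) \<le> C" for i
        using deriv
      proof eventually_elim
        case (elim x)
        have "norm (f (X i) x - f t0 x) \<le> C * norm (X i - t0)"
        proof (rule field_differentiable_bound[where S="?I" and f'="\<lambda>t. f' t x"])
          show "((\<lambda>t. f t x) has_field_derivative f' t x) (at t within ?I)" if "t \<in> ?I" for t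
            using elim that by (auto intro: has_field_derivative_at_within)
        qed (use elim X t0 in auto)
        then show ?case
          using X by (simp add: divide_le_eq)
      qed
      show "(\<lambda>x. (f (X i) x - f t0 x) / (X i - t0)) \<in> borel_measurable M" for i
        using meas(1)[of "X i"] meas(1)[OF t0] X by auto
    qed (use meas in auto)
    moreover have "expectation (\<lambda>x. (f (X i) x - f t0 x) / (X i - t0))
        = (expectation (f (X i)) - expectation (f t0)) / (X i - t0)" for i
      using Bochner_Integration.integral_diff[OF meas(1)[of "X i"] meas(1)[OF t0]] X by simp
    ultimately show "((\<lambda>t. (expectation (f t) - expectation (f t0)) / (t - t0)) \<circ> X) \<longlonglongrightarrow> expectation (f' t0)"
      by (simp only: comp_def)
  qed
  moreover have "at t0 within ?I = at t0"
    using t0 by (intro at_within_open) auto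
  ultimately show ?thesis
    by (simp add: has_field_derivative_iff)
qed

lemma abs_exp_mult_le: "exp a \<le> C \<Longrightarrow> \<bar>b\<bar> \<le> D \<Longrightarrow> \<bar>exp a * b\<bar> \<le> C * (D :: real)"
  unfolding abs_mult by (rule mult_mono) (auto intro: order_trans[OF exp_ge_zero])

text \<open>The Riesz isometry, which turns the operator norm in the logarithmic Sobolev inequality
  into the norm of a gradient vector.\<close>

lemma norm_blinfun_inner_right: "norm (blinfun_inner_right z) = norm (z :: 'a::real_inner)"
proof (rule antisym)
  show "norm (blinfun_inner_right z) \<le> norm z"
    by (rule norm_blinfun_bound) (auto simp: Cauchy_Schwarz_ineq2)
  have "norm z * norm z \<le> norm (blinfun_inner_right z) * norm z"
    using norm_blinfun[of "blinfun_inner_right z" z] by (simp add: norm_eq_sqrt_inner)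
  then show "norm z \<le> norm (blinfun_inner_right z)"
    by (cases "z = 0") auto
qed

text \<open>The Gibbs measure enters the transport argument only through these properties. Test
  functions are C^1 on the whole space, as the soft minima are, and such functions restrict to any
  ball.\<close>

locale log_sobolev_space = prob_space M for M :: "'a::real_inner measure" +
  fixes K :: "'a set" and \<alpha> :: real
  assumes sets_eq: "sets M = sets borel"
    and compact_K: "compact K" and AE_K: "AE x in M. x \<in> K"
    and \<alpha>_pos: "\<alpha> > 0"
    and log_sobolev: "\<And>F F'. \<lbrakk>\<And>x. (F has_derivative blinfun_apply (F' x)) (at x); continuous_on UNIV F'\<rbrakk> \<Longrightarrow>
      (\<integral>x. (F x)\<^sup>2 * ln ((F x)\<^sup>2 / (\<integral>y. (F y)\<^sup>2 \<partial>M)) \<partial>M) \<le> 2 / \<alpha> * (\<integral>x. (norm (F' x))\<^sup>2 \<partial>M)"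
begin

lemma space_eq [simp]: "space M = UNIV"
  using sets_eq_imp_space_eq[OF sets_eq] by simp

lemma continuous_measurable: "continuous_on UNIV h \<Longrightarrow> h \<in> borel_measurable M"
  using borel_measurable_continuous_onI measurable_cong_sets[OF sets_eq refl] by blast

lemma integrable_bounded_on:
  fixes h :: "'a \<Rightarrow> real"
  assumes "h \<in> borel_measurable M" "\<And>x. x \<in> K \<Longrightarrow> \<bar>h x\<bar> \<le> C"
  shows "integrable M h"
  by (rule integrable_const_bound[where B=C]) (use AE_K assms in \<open>auto elim: eventually_mono\<close>)

lemma expectation_pos_bounded_on:
  assumes "integrable M h" "\<And>x. x \<in> K \<Longrightarrow> c \<le> h x" "0 < (c :: real)"
  shows "0 < expectation h"
proof -
  have "c \<le> expectation h"
    by (rule integral_ge_const[OF assms(1)]) (use AE_K assms(2) in \<open>auto elim: eventually_mono\<close>)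
  then show ?thesis using assms(3) by linarith
qed

text \<open>The test function is F = exp (\<tau> v / 2), with F^2 = exp (\<tau> v) and gradient
  (\<tau> / 2) F times that of v. The factor is then (2 / \<alpha>) (\<tau>^2 / 4), and the left
  side is the entropy of exp (\<tau> v).\<close>

lemma log_sobolev_exp:
  fixes v :: "'a \<Rightarrow> real" and gr :: "'a \<Rightarrow> 'a" and \<tau> B :: real
  assumes gr: "\<And>x. (v has_derivative (\<lambda>h. gr x \<bullet> h)) (at x)" "continuous_on UNIV gr"
    and B: "\<And>x. x \<in> K \<Longrightarrow> \<bar>v x\<bar> \<le> B"
  shows "(\<integral>x. exp (\<tau> * v x) * (\<tau> * v x) \<partial>M) - (\<integral>x. exp (\<tau> * v x) \<partial>M) * ln (\<integral>x. exp (\<tau> * v x) \<partial>M)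
    \<le> \<tau>\<^sup>2 / (2 * \<alpha>) * (\<integral>x. exp (\<tau> * v x) * (norm (gr x))\<^sup>2 \<partial>M)"
proof -
  define F where "F x = exp (\<tau> * v x / 2)" for x
  define F' where "F' x = blinfun_inner_right ((F x * \<tau> / 2) *\<^sub>R gr x)" for x
  define E where "E = (\<integral>x. exp (\<tau> * v x) \<partial>M)"
  have contv: "continuous_on UNIV v"
    using gr(1) by (meson has_derivative_continuous continuous_at_imp_continuous_on)
  have F2: "(F x)\<^sup>2 = exp (\<tau> * v x)" for x
    by (simp add: F_def power2_eq_square exp_add[symmetric])
  have derF: "(F has_derivative blinfun_apply (F' x)) (at x)" for x
    unfolding F_def F'_def
    by (auto intro!: derivative_eq_intros gr(1) simp: inner_scaleR_left)
  have "continuous_on UNIV F'"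
    unfolding F'_def F_def by (intro bounded_linear.continuous_on[OF bounded_linear_blinfun_inner_right] continuous_intros contv gr(2)) auto
  note ls = log_sobolev[OF derF this]
  have normF': "(norm (F' x))\<^sup>2 = \<tau>\<^sup>2 / 4 * (exp (\<tau> * v x) * (norm (gr x))\<^sup>2)" for x
  proof -
    have "F' x = blinfun_inner_right ((F x * \<tau> / 2) *\<^sub>R gr x)" by (simp add: F'_def)
    then show ?thesis
      by (simp add: norm_blinfun_inner_right power_mult_distrib F2[symmetric] power_divide)
  qed
  have meas: "(\<lambda>x. exp (\<tau> * v x)) \<in> borel_measurable M" "(\<lambda>x. exp (\<tau> * v x) * (\<tau> * v x)) \<in> borel_measurable M"
    by (intro continuous_measurable continuous_intros contv)+
  have bd: "\<bar>\<tau> * v x\<bar> \<le> \<bar>\<tau>\<bar> * B" if "x \<in> K" for x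
    using B[OF that] by (auto simp: abs_mult intro: mult_left_mono)
  have ebd: "exp (\<tau> * v x) \<le> exp (\<bar>\<tau>\<bar> * B)" if "x \<in> K" for x
    using bd[OF that] by (simp add: abs_le_iff)
  have int1: "integrable M (\<lambda>x. exp (\<tau> * v x))"
    by (rule integrable_bounded_on[OF meas(1), where C="exp (\<bar>\<tau>\<bar> * B)"]) (use ebd in auto)
  have int2: "integrable M (\<lambda>x. exp (\<tau> * v x) * (\<tau> * v x))"
    by (rule integrable_bounded_on[OF meas(2), where C="exp (\<bar>\<tau>\<bar> * B) * (\<bar>\<tau>\<bar> * B)"])
      (use ebd bd in \<open>blast intro: abs_exp_mult_le\<close>)
  have "0 < E"
    unfolding E_def by (rule expectation_pos_bounded_on[OF int1, where c="exp (- (\<bar>\<tau>\<bar> * B))"])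
      (use bd in \<open>force simp: abs_le_iff\<close>, simp)
  have "(\<integral>x. (F x)\<^sup>2 * ln ((F x)\<^sup>2 / (\<integral>y. (F y)\<^sup>2 \<partial>M)) \<partial>M)
      = (\<integral>x. exp (\<tau> * v x) * (\<tau> * v x) - exp (\<tau> * v x) * ln E \<partial>M)"
    unfolding F2 E_def[symmetric] using \<open>0 < E\<close> by (simp add: ln_div right_diff_distrib)
  also have "\<dots> = (\<integral>x. exp (\<tau> * v x) * (\<tau> * v x) \<partial>M) - E * ln E"
    using int1 int2 by (simp add: E_def)
  finally show ?thesis
    using ls unfolding normF' E_def[symmetric] by (simp add: power2_eq_square)
qed

text \<open>With E t the integral of exp (\<alpha> t v), the derivative of ln (E t) / (\<alpha> t)
  has the sign of t E' - E ln E. The subsolution property contributes -(\<alpha> t^2 / 2) times the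
  weighted integral of |grad v|^2 to t E', and the logarithmic Sobolev inequality at \<tau> =
  \<alpha> t has exactly the constant \<alpha> t^2 / 2, so the two cancel.\<close>

lemma hopf_cole_antimono:
  fixes v vt :: "real \<Rightarrow> 'a \<Rightarrow> real" and gr :: "real \<Rightarrow> 'a \<Rightarrow> 'a"
  assumes lu: "0 \<le> l" "l < s" "s \<le> r" "r < u"
    and gr: "\<And>t x. t \<in> {l<..<u} \<Longrightarrow> (v t has_derivative (\<lambda>h. gr t x \<bullet> h)) (at x)"
      "\<And>t. t \<in> {l<..<u} \<Longrightarrow> continuous_on UNIV (gr t)"
    and vt: "\<And>t x. t \<in> {l<..<u} \<Longrightarrow> ((\<lambda>t. v t x) has_real_derivative vt t x) (at t)"
      "\<And>t. t \<in> {l<..<u} \<Longrightarrow> continuous_on UNIV (vt t)"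
    and B: "\<And>t x. t \<in> {l<..<u} \<Longrightarrow> x \<in> K \<Longrightarrow> \<bar>v t x\<bar> \<le> B \<and> \<bar>vt t x\<bar> \<le> B"
    and sub: "\<And>t x. t \<in> {l<..<u} \<Longrightarrow> vt t x + (norm (gr t x))\<^sup>2 / 2 \<le> 0"
  shows "ln (\<integral>x. exp (\<alpha> * r * v r x) \<partial>M) / (\<alpha> * r) \<le> ln (\<integral>x. exp (\<alpha> * s * v s x) \<partial>M) / (\<alpha> * s)"
proof -
  define E where "E t = (\<integral>x. exp (\<alpha> * t * v t x) \<partial>M)" for t
  define e' where "e' t x = exp (\<alpha> * t * v t x) * (\<alpha> * v t x + \<alpha> * t * vt t x)" for t x
  have contv: "continuous_on UNIV (v t)" if "t \<in> {l<..<u}" for t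
    using gr(1)[OF that] by (meson has_derivative_continuous continuous_at_imp_continuous_on)
  have tpos: "0 < t" "t < u" if "t \<in> {l<..<u}" for t using that lu by auto
  have bd: "\<bar>\<alpha> * t * v t x\<bar> \<le> \<alpha> * u * B" if "t \<in> {l<..<u}" "x \<in> K" for t x
    using B[OF that] tpos[OF that(1)] \<alpha>_pos by (auto simp: abs_mult intro!: mult_mono)
  have ebd: "exp (\<alpha> * t * v t x) \<le> exp (\<alpha> * u * B)" if "t \<in> {l<..<u}" "x \<in> K" for t x
    using bd[OF that] by (simp add: abs_le_iff)
  have int: "integrable M (\<lambda>x. exp (\<alpha> * t * v t x))" if "t \<in> {l<..<u}" for t
    by (rule integrable_bounded_on[where C="exp (\<alpha> * u * B)"])
      (use ebd[OF that] in \<open>auto intro!: continuous_measurable continuous_intros contv[OF that]\<close>)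
  have meas': "e' t \<in> borel_measurable M" if "t \<in> {l<..<u}" for t
    unfolding e'_def by (intro continuous_measurable continuous_intros contv vt that)
  have bd': "\<bar>e' t x\<bar> \<le> exp (\<alpha> * u * B) * (\<alpha> * B + \<alpha> * u * B)" if "t \<in> {l<..<u}" "x \<in> K" for t x
  proof -
    have "\<bar>\<alpha> * v t x + \<alpha> * t * vt t x\<bar> \<le> \<bar>\<alpha> * v t x\<bar> + \<bar>\<alpha> * t * vt t x\<bar>" by (rule abs_triangle_ineq)
    also have "\<dots> \<le> \<alpha> * B + \<alpha> * u * B"
      using B[OF that] tpos[OF that(1)] \<alpha>_pos by (intro add_mono) (auto simp: abs_mult intro!: mult_mono)
    finally show ?thesis
      unfolding e'_def abs_mult using ebd[OF that] by (intro mult_mono) auto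
  qed
  have derE: "(E has_real_derivative (\<integral>x. e' t x \<partial>M)) (at t)" if "t \<in> {l<..<u}" for t
    unfolding E_def
  proof (rule has_real_derivative_expectation[OF that])
    show "AE x in M. \<forall>t\<in>{l<..<u}. ((\<lambda>t. exp (\<alpha> * t * v t x)) has_real_derivative e' t x) (at t)
        \<and> \<bar>e' t x\<bar> \<le> exp (\<alpha> * u * B) * (\<alpha> * B + \<alpha> * u * B)"
      using AE_K
    proof eventually_elim
      case (elim x)
      show ?case
      proof (intro ballI conjI bd'[OF _ elim])
        fix t assume t: "t \<in> {l<..<u}"
        show "((\<lambda>t. exp (\<alpha> * t * v t x)) has_real_derivative e' t x) (at t)"
          unfolding e'_def by (auto intro!: derivative_eq_intros vt[OF t])
      qed
    qed
  qed (use int meas' that in auto)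
  have Epos: "E t > 0" if "t \<in> {l<..<u}" for t
    unfolding E_def by (rule expectation_pos_bounded_on[OF int[OF that], where c="exp (- (\<alpha> * u * B))"])
      (use bd[OF that] in \<open>force simp: abs_le_iff\<close>, simp)
  have key: "t * (\<integral>x. e' t x \<partial>M) \<le> E t * ln (E t)" if t: "t \<in> {l<..<u}" for t
  proof -
    let ?e = "\<lambda>x. exp (\<alpha> * t * v t x)"
    have cont: "continuous_on UNIV (gr t)" "continuous_on UNIV (vt t)" "continuous_on UNIV (v t)"
      using gr(2)[OF t] vt(2)[OF t] contv[OF t] by auto
    \<comment> \<open>The subsolution inequality itself bounds the gradient, through the bound on
      the time derivative.\<close>
    have gbd: "(norm (gr t x))\<^sup>2 \<le> 2 * B" if "x \<in> K" for x
      using sub[OF t, of x] B[OF t that] by linarith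
    have i1: "integrable M (\<lambda>x. ?e x * (\<alpha> * t * v t x))"
      by (rule integrable_bounded_on[where C="exp (\<alpha> * u * B) * (\<alpha> * u * B)"])
       (use ebd[OF t] bd[OF t] in \<open>auto intro!: abs_exp_mult_le continuous_measurable continuous_intros cont\<close>)
    have i2: "integrable M (\<lambda>x. ?e x * vt t x)"
      by (rule integrable_bounded_on[where C="exp (\<alpha> * u * B) * B"])
       (use ebd[OF t] B[OF t] in \<open>auto intro!: abs_exp_mult_le continuous_measurable continuous_intros cont\<close>)
    have "\<bar>(norm (gr t x))\<^sup>2\<bar> \<le> 2 * B" if "x \<in> K" for x using gbd[OF that] by simp
    then have "\<bar>?e x * (norm (gr t x))\<^sup>2\<bar> \<le> exp (\<alpha> * u * B) * (2 * B)" if "x \<in> K" for x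
      using abs_exp_mult_le[OF ebd[OF t that]] that by blast
    moreover have "(\<lambda>x. ?e x * (norm (gr t x))\<^sup>2) \<in> borel_measurable M"
      by (intro continuous_measurable continuous_intros cont)
    ultimately have i3: "integrable M (\<lambda>x. ?e x * (norm (gr t x))\<^sup>2)"
      by (intro integrable_bounded_on)
    have "t * (\<integral>x. e' t x \<partial>M) = (\<integral>x. ?e x * (\<alpha> * t * v t x) + \<alpha> * t\<^sup>2 * (?e x * vt t x) \<partial>M)"
      unfolding integral_mult_right_zero[symmetric] e'_def
      by (intro Bochner_Integration.integral_cong refl) (simp add: algebra_simps power2_eq_square)
    also have "\<dots> = (\<integral>x. ?e x * (\<alpha> * t * v t x) \<partial>M) + \<alpha> * t\<^sup>2 * (\<integral>x. ?e x * vt t x \<partial>M)"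
      using i1 i2 by simp
    also have "(\<integral>x. ?e x * vt t x \<partial>M) \<le> (\<integral>x. - (1/2) * (?e x * (norm (gr t x))\<^sup>2) \<partial>M)"
    proof (intro integral_mono i2 integrable_mult_right i3)
      fix x
      have "vt t x \<le> - (1/2) * (norm (gr t x))\<^sup>2" using sub[OF t, of x] by linarith
      then have "?e x * vt t x \<le> ?e x * (- (1/2) * (norm (gr t x))\<^sup>2)"
        by (intro mult_left_mono) auto
      then show "?e x * vt t x \<le> - (1/2) * (?e x * (norm (gr t x))\<^sup>2)" by simp
    qed
    also have "\<dots> = - (1/2) * (\<integral>x. ?e x * (norm (gr t x))\<^sup>2 \<partial>M)" by simp
    finally have "t * (\<integral>x. e' t x \<partial>M) \<le> (\<integral>x. ?e x * (\<alpha> * t * v t x) \<partial>M)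
        - \<alpha> * t\<^sup>2 / 2 * (\<integral>x. ?e x * (norm (gr t x))\<^sup>2 \<partial>M)"
      using \<alpha>_pos by (simp add: mult_left_mono)
    moreover have "(\<integral>x. ?e x * (\<alpha> * t * v t x) \<partial>M) - E t * ln (E t)
        \<le> (\<alpha> * t)\<^sup>2 / (2 * \<alpha>) * (\<integral>x. ?e x * (norm (gr t x))\<^sup>2 \<partial>M)"
      unfolding E_def by (rule log_sobolev_exp[OF gr(1)[OF t] cont(1)]) (use B[OF t] in auto)
    moreover have "(\<alpha> * t)\<^sup>2 / (2 * \<alpha>) = \<alpha> * t\<^sup>2 / 2"
      using \<alpha>_pos by (simp add: power2_eq_square)
    ultimately show ?thesis by simp
  qed
  have "ln (E r) / (\<alpha> * r) \<le> ln (E s) / (\<alpha> * s)"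
  proof (rule DERIV_nonpos_imp_nonincreasing[OF lu(3)])
    fix t assume "s \<le> t" "t \<le> r"
    then have t: "t \<in> {l<..<u}" using lu by auto
    have "((\<lambda>t. ln (E t) / (\<alpha> * t)) has_real_derivative
        (t * (\<integral>x. e' t x \<partial>M) - E t * ln (E t)) / (\<alpha> * t\<^sup>2 * E t)) (at t)"
      by (rule derivative_eq_intros derE t Epos refl)+
        (use \<alpha>_pos tpos[OF t] Epos[OF t] in \<open>auto simp: field_simps power2_eq_square\<close>)
    moreover have "(t * (\<integral>x. e' t x \<partial>M) - E t * ln (E t)) / (\<alpha> * t\<^sup>2 * E t) \<le> 0"
      using key[OF t] \<alpha>_pos tpos[OF t] Epos[OF t] by (intro divide_nonpos_pos) auto
    ultimately show "\<exists>y. ((\<lambda>t. ln (E t) / (\<alpha> * t)) has_real_derivative y) (at t) \<and> y \<le> 0"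
      by blast
  qed
  then show ?thesis by (simp add: E_def)
qed

end

section \<open>The smoothed Hopf--Lax formula\<close>

text \<open>\<open>hopf_lax J \<phi> y \<eta> t x\<close> is the soft minimum at temperature \<open>\<eta>\<close> of
  \<open>\<phi> j + |x - y j|\<^sup>2 / (2 t)\<close>. Each of these functions of \<open>(t, x)\<close> solves \<open>\<partial>v/\<partial>t + |\<nabla>v|\<^sup>2 / 2 = 0\<close>, and the
  soft minimum is still a subsolution, by Jensen's inequality for the squared norm.\<close>

definition hopf_lax :: "'j set \<Rightarrow> ('j \<Rightarrow> real) \<Rightarrow> ('j \<Rightarrow> 'a::real_inner) \<Rightarrow> real \<Rightarrow> real \<Rightarrow> 'a \<Rightarrow> real" where
  "hopf_lax J \<phi> y \<eta> t x = - \<eta> * ln (\<Sum>j\<in>J. exp (- (\<phi> j + (x - y j) \<bullet> (x - y j) / (2 * t)) / \<eta>))"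

text \<open>Gibbs probabilities of the candidates j at temperature \<open>\<eta>\<close>. The
  derivatives of the soft minimum are averages under them of the derivatives of the individual
  candidates.\<close>

definition hopf_lax_weight :: "'j set \<Rightarrow> ('j \<Rightarrow> real) \<Rightarrow> ('j \<Rightarrow> 'a::real_inner) \<Rightarrow> real \<Rightarrow> real \<Rightarrow> 'a \<Rightarrow> 'j \<Rightarrow> real" where
  "hopf_lax_weight J \<phi> y \<eta> t x j = exp (- (\<phi> j + (x - y j) \<bullet> (x - y j) / (2 * t)) / \<eta>)
     / (\<Sum>i\<in>J. exp (- (\<phi> i + (x - y i) \<bullet> (x - y i) / (2 * t)) / \<eta>))"

definition hopf_lax_grad :: "'j set \<Rightarrow> ('j \<Rightarrow> real) \<Rightarrow> ('j \<Rightarrow> 'a::real_inner) \<Rightarrow> real \<Rightarrow> real \<Rightarrow> 'a \<Rightarrow> 'a" where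
  "hopf_lax_grad J \<phi> y \<eta> t x = (\<Sum>j\<in>J. hopf_lax_weight J \<phi> y \<eta> t x j *\<^sub>R ((1 / t) *\<^sub>R (x - y j)))"

definition hopf_lax_dt :: "'j set \<Rightarrow> ('j \<Rightarrow> real) \<Rightarrow> ('j \<Rightarrow> 'a::real_inner) \<Rightarrow> real \<Rightarrow> real \<Rightarrow> 'a \<Rightarrow> real" where
  "hopf_lax_dt J \<phi> y \<eta> t x = - (\<Sum>j\<in>J. hopf_lax_weight J \<phi> y \<eta> t x j * ((x - y j) \<bullet> (x - y j) / (2 * t\<^sup>2)))"

context
  fixes J :: "'j set" and \<phi> :: "'j \<Rightarrow> real" and y :: "'j \<Rightarrow> 'a::real_inner" and \<eta> :: real
  assumes fin: "finite J" and ne: "J \<noteq> {}" and \<eta>: "\<eta> > 0"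
begin

lemma hopf_lax_sum_pos: "0 < (\<Sum>i\<in>J. exp (- (\<phi> i + (x - y i) \<bullet> (x - y i) / (2 * t)) / \<eta>))"
  using fin ne by (intro sum_pos) auto

lemma hopf_lax_weight_nonneg: "0 \<le> hopf_lax_weight J \<phi> y \<eta> t x j"
  unfolding hopf_lax_weight_def by (intro divide_nonneg_nonneg sum_nonneg) auto

lemma sum_hopf_lax_weight: "(\<Sum>j\<in>J. hopf_lax_weight J \<phi> y \<eta> t x j) = 1"
  unfolding hopf_lax_weight_def sum_divide_distrib[symmetric]
  using hopf_lax_sum_pos[of x t] by simp

lemma hopf_lax_le:
  \<comment> \<open>A single term of the sum of exponentials is at most the sum, so the soft minimum
    lies below each candidate.\<close>
  assumes "j \<in> J"
  shows "hopf_lax J \<phi> y \<eta> t x \<le> \<phi> j + (x - y j) \<bullet> (x - y j) / (2 * t)"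
proof -
  let ?c = "\<lambda>j. \<phi> j + (x - y j) \<bullet> (x - y j) / (2 * t)"
  have "exp (- ?c j / \<eta>) \<le> (\<Sum>i\<in>J. exp (- ?c i / \<eta>))"
    using assms fin by (intro member_le_sum) auto
  then have "- ?c j / \<eta> \<le> ln (\<Sum>i\<in>J. exp (- ?c i / \<eta>))"
    using hopf_lax_sum_pos[of x t] by (subst ln_ge_iff) auto
  then show ?thesis
    unfolding hopf_lax_def using \<eta> by (simp add: field_simps)
qed

text \<open>The sum has |J| terms, each at most exp (- m / \<eta>); this is where the smoothing
  error \<eta> ln |J| comes from.\<close>

lemma hopf_lax_ge:
  assumes "\<And>j. j \<in> J \<Longrightarrow> m \<le> \<phi> j + (x - y j) \<bullet> (x - y j) / (2 * t)"
  shows "m - \<eta> * ln (card J) \<le> hopf_lax J \<phi> y \<eta> t x"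
proof -
  let ?c = "\<lambda>j. \<phi> j + (x - y j) \<bullet> (x - y j) / (2 * t)"
  have card: "0 < real (card J)" using fin ne by (simp add: card_gt_0_iff)
  have "(\<Sum>i\<in>J. exp (- ?c i / \<eta>)) \<le> (\<Sum>i\<in>J. exp (- m / \<eta>))"
  proof (rule sum_mono)
    fix i assume "i \<in> J"
    have "- ?c i / \<eta> \<le> - m / \<eta>"
      using assms[OF \<open>i \<in> J\<close>] \<eta> by (intro divide_right_mono) auto
    then show "exp (- ?c i / \<eta>) \<le> exp (- m / \<eta>)" by (rule exp_le_cancel_iff[THEN iffD2])
  qed
  then have "ln (\<Sum>i\<in>J. exp (- ?c i / \<eta>)) \<le> ln (real (card J) * exp (- m / \<eta>))"
    using hopf_lax_sum_pos[of x t] by (intro ln_mono) auto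
  also have "\<dots> = ln (card J) - m / \<eta>"
    using card by (simp add: ln_mult)
  finally have "\<eta> * ln (\<Sum>i\<in>J. exp (- ?c i / \<eta>)) \<le> \<eta> * (ln (card J) - m / \<eta>)"
    using \<eta> by (intro mult_left_mono) auto
  then show ?thesis
    unfolding hopf_lax_def using \<eta> by (simp add: algebra_simps)
qed

lemma has_derivative_hopf_lax:
  assumes "t > 0"
  shows "(hopf_lax J \<phi> y \<eta> t has_derivative (\<lambda>h. hopf_lax_grad J \<phi> y \<eta> t x \<bullet> h)) (at x)"
proof -
  let ?e = "\<lambda>x j. exp (- (\<phi> j + (x - y j) \<bullet> (x - y j) / (2 * t)) / \<eta>)"
  let ?d = "\<lambda>h. \<Sum>j\<in>J. ?e x j * (- (((x - y j) \<bullet> h) / t) / \<eta>)"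
  have "((\<lambda>x. ?e x j) has_derivative (\<lambda>h. ?e x j * (- (((x - y j) \<bullet> h) / t) / \<eta>))) (at x)" for j
  proof -
    have "((\<lambda>x. (x - y j) \<bullet> (x - y j)) has_derivative (\<lambda>h. 2 * ((x - y j) \<bullet> h))) (at x)"
      by (auto intro!: derivative_eq_intros simp: inner_commute)
    then have "((\<lambda>x. - (\<phi> j + (x - y j) \<bullet> (x - y j) / (2 * t)) / \<eta>) has_derivative
        (\<lambda>h. - (0 + 2 * ((x - y j) \<bullet> h) / (2 * t)) / \<eta>)) (at x)"
      by (intro derivative_intros bounded_linear.has_derivative[OF bounded_linear_divide])
    from has_derivative_exp[OF this] show ?thesis
      by (simp add: mult.commute)
  qed
  then have "((\<lambda>x. \<Sum>j\<in>J. ?e x j) has_derivative ?d) (at x)"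
    by (intro has_derivative_sum) auto
  from has_derivative_mult_right[OF has_derivative_ln[OF _ this], of "- \<eta>"]
  have "(hopf_lax J \<phi> y \<eta> t has_derivative (\<lambda>h. - \<eta> * (?d h * inverse (\<Sum>j\<in>J. ?e x j)))) (at x)"
    unfolding hopf_lax_def[abs_def] using hopf_lax_sum_pos[of x t] by simp
  moreover have "- \<eta> * (?d h * inverse (\<Sum>j\<in>J. ?e x j)) = hopf_lax_grad J \<phi> y \<eta> t x \<bullet> h" for h
    unfolding hopf_lax_grad_def hopf_lax_weight_def inner_sum_left sum_distrib_left sum_distrib_right
    using \<eta> by (intro sum.cong refl) (simp add: inverse_eq_divide)
  ultimately show ?thesis by simp
qed

lemma has_real_derivative_hopf_lax:
  assumes "t > 0"
  shows "((\<lambda>t. hopf_lax J \<phi> y \<eta> t x) has_real_derivative hopf_lax_dt J \<phi> y \<eta> t x) (at t)"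
proof -
  let ?e = "\<lambda>t j. exp (- (\<phi> j + (x - y j) \<bullet> (x - y j) / (2 * t)) / \<eta>)"
  let ?d = "\<Sum>j\<in>J. ?e t j * (((x - y j) \<bullet> (x - y j)) / (2 * t\<^sup>2) / \<eta>)"
  have "((\<lambda>t. ?e t j) has_real_derivative ?e t j * (((x - y j) \<bullet> (x - y j)) / (2 * t\<^sup>2) / \<eta>)) (at t)" for j
    using assms \<eta> by (auto intro!: derivative_eq_intros simp: field_simps power2_eq_square)
  then have "((\<lambda>t. \<Sum>j\<in>J. ?e t j) has_real_derivative ?d) (at t)"
    by (intro DERIV_sum) auto
  from DERIV_cmult[OF DERIV_chain2[OF DERIV_ln[OF hopf_lax_sum_pos] this], of "- \<eta>"]
  have "((\<lambda>t. hopf_lax J \<phi> y \<eta> t x) has_real_derivative - \<eta> * (inverse (\<Sum>j\<in>J. ?e t j) * ?d)) (at t)"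
    unfolding hopf_lax_def by simp
  moreover have "- \<eta> * (inverse (\<Sum>j\<in>J. ?e t j) * ?d) = hopf_lax_dt J \<phi> y \<eta> t x"
    unfolding hopf_lax_dt_def hopf_lax_weight_def sum_distrib_left sum_negf[symmetric]
    using \<eta> by (intro sum.cong refl) (simp add: inverse_eq_divide)
  ultimately show ?thesis by simp
qed

lemma continuous_on_hopf_lax_weight:
  "continuous_on UNIV (\<lambda>x. hopf_lax_weight J \<phi> y \<eta> t x j)"
proof -
  have c: "continuous_on UNIV (\<lambda>x. exp (- (\<phi> j + (x - y j) \<bullet> (x - y j) / (2 * t)) / \<eta>))" for j
    unfolding divide_inverse by (intro continuous_intros)
  show ?thesis
    unfolding hopf_lax_weight_def
    by (intro continuous_on_divide continuous_on_sum c) (use hopf_lax_sum_pos in \<open>auto simp: less_le\<close>)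
qed

lemma continuous_on_hopf_lax_grad: "continuous_on UNIV (hopf_lax_grad J \<phi> y \<eta> t)"
  unfolding hopf_lax_grad_def[abs_def]
  by (intro continuous_on_sum continuous_on_scaleR continuous_on_hopf_lax_weight continuous_intros)

lemma continuous_on_hopf_lax_dt: "continuous_on UNIV (hopf_lax_dt J \<phi> y \<eta> t)"
  unfolding hopf_lax_dt_def[abs_def] divide_inverse
  by (intro continuous_on_sum continuous_on_mult continuous_on_hopf_lax_weight continuous_intros)

text \<open>The left side is minus half the variance of the vectors (x - y j) / t under the weights,
  whose mean is the gradient G.\<close>

lemma hopf_lax_subsolution:
  assumes "t > 0"
  shows "hopf_lax_dt J \<phi> y \<eta> t x + (norm (hopf_lax_grad J \<phi> y \<eta> t x))\<^sup>2 / 2 \<le> 0"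
proof -
  let ?p = "hopf_lax_weight J \<phi> y \<eta> t x" and ?z = "\<lambda>j. (1 / t) *\<^sub>R (x - y j)"
  define G where "G = hopf_lax_grad J \<phi> y \<eta> t x"
  have G: "G = (\<Sum>j\<in>J. ?p j *\<^sub>R ?z j)" by (simp add: G_def hopf_lax_grad_def)
  have sq: "(z - G) \<bullet> (z - G) = z \<bullet> z - 2 * (z \<bullet> G) + G \<bullet> G" for z
    by (simp add: inner_diff_left inner_diff_right inner_commute)
  have "0 \<le> (\<Sum>j\<in>J. ?p j * ((?z j - G) \<bullet> (?z j - G)))"
    by (intro sum_nonneg mult_nonneg_nonneg hopf_lax_weight_nonneg) auto
  also have "\<dots> = (\<Sum>j\<in>J. ?p j * (?z j \<bullet> ?z j) - 2 * (?p j * (?z j \<bullet> G)) + ?p j * (G \<bullet> G))"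
    by (simp only: sq distrib_left right_diff_distrib mult.left_commute[of _ 2])
  also have "\<dots> = (\<Sum>j\<in>J. ?p j * (?z j \<bullet> ?z j)) - 2 * (\<Sum>j\<in>J. ?p j * (?z j \<bullet> G)) + (G \<bullet> G)"
    by (simp only: sum.distrib sum_subtractf sum_distrib_left[symmetric] sum_distrib_right[symmetric] sum_hopf_lax_weight mult_1)
  also have "(\<Sum>j\<in>J. ?p j * (?z j \<bullet> G)) = G \<bullet> G"
    by (subst (2) G) (simp only: inner_sum_left inner_scaleR_left)
  finally have "G \<bullet> G \<le> (\<Sum>j\<in>J. ?p j * (?z j \<bullet> ?z j))" by simp
  moreover have "(\<Sum>j\<in>J. ?p j * (?z j \<bullet> ?z j)) = - 2 * hopf_lax_dt J \<phi> y \<eta> t x"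
    unfolding hopf_lax_dt_def mult_minus_left mult_minus_right minus_minus
    unfolding sum_distrib_left by (intro sum.cong refl) (simp add: power2_eq_square)
  ultimately show ?thesis
    by (simp add: G_def power2_norm_eq_inner)
qed

end

section \<open>Relative entropy and couplings\<close>

text \<open>One half of the Gibbs (Donsker--Varadhan) variational principle: integrate ln k \<le> k
  - 1 for k = exp h / (Z \<rho>) against \<rho> M. The integral of k is at most 1, and possibly
  smaller because the set where \<rho> vanishes is lost.\<close>

lemma (in prob_space) entropy_inequality:
  fixes \<rho> h :: "'a \<Rightarrow> real"
  assumes \<rho>: "\<rho> \<in> borel_measurable M" "\<And>x. 0 \<le> \<rho> x" and N: "prob_space (density M \<rho>)"
    and h: "integrable M (\<lambda>x. exp (h x))" "integrable (density M \<rho>) h"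
    and ent: "integrable (density M \<rho>) (\<lambda>x. ln (\<rho> x))"
  shows "(\<integral>x. h x \<partial>density M \<rho>) \<le> (\<integral>x. ln (\<rho> x) \<partial>density M \<rho>) + ln (\<integral>x. exp (h x) \<partial>M)"
proof -
  let ?N = "density M \<rho>"
  interpret N: prob_space ?N by fact
  define Z where "Z = (\<integral>x. exp (h x) \<partial>M)"
  have pos: "AE x in ?N. 0 < \<rho> x"
    using \<rho> by (subst AE_density) (auto simp: ennreal_zero_less_divide)
  have "Z > 0"
  proof -
    have "\<not> (AE x in M. exp (h x) = 0)" by (simp add: AE_False emeasure_space_1)
    then have "Z \<noteq> 0"
      unfolding Z_def using h(1) by (subst integral_nonneg_eq_0_iff_AE) auto
    moreover have "Z \<ge> 0" unfolding Z_def by (rule Bochner_Integration.integral_nonneg) auto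
    ultimately show ?thesis by simp
  qed
  define k where "k x = exp (h x) / (Z * \<rho> x)" for x
  have hM[measurable]: "h \<in> borel_measurable M" using h(2) by auto
  \<comment> \<open>Where \<rho> vanishes, \<open>k\<close> is 0 by the convention for division by
    0, and the bound persists.\<close>
  have k_le: "\<rho> x * k x \<le> exp (h x) / Z" for x
    using \<open>Z > 0\<close> by (cases "\<rho> x = 0") (auto simp: k_def)
  have k_nn: "0 \<le> k x" for x using \<open>Z > 0\<close> \<rho>(2) by (simp add: k_def)
  have km[measurable]: "k \<in> borel_measurable M" unfolding k_def using \<rho>(1) by measurable
  have i1: "integrable M (\<lambda>x. \<rho> x * k x)"
  proof (rule Bochner_Integration.integrable_bound[where f="\<lambda>x. exp (h x) / Z"])
    show "AE x in M. norm (\<rho> x * k x) \<le> norm (exp (h x) / Z)"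
      using k_le k_nn \<rho>(2) \<open>Z > 0\<close> by simp
  qed (use h \<rho> in auto)
  have ik: "integrable ?N k"
    using i1 \<rho> by (subst integrable_density) auto
  have "(\<integral>x. k x \<partial>?N) = (\<integral>x. \<rho> x * k x \<partial>M)"
    using \<rho> by (subst integral_density) auto
  also have "\<dots> \<le> (\<integral>x. exp (h x) / Z \<partial>M)"
    using i1 h(1) k_le by (intro integral_mono) auto
  also have "\<dots> = 1" using \<open>Z > 0\<close> by (simp add: Z_def)
  finally have k1: "(\<integral>x. k x \<partial>?N) \<le> 1" .
  have "(\<integral>x. h x - ln (\<rho> x) - ln Z \<partial>?N) \<le> (\<integral>x. k x - 1 \<partial>?N)"
  proof (intro integral_mono_AE)
    show "AE x in ?N. h x - ln (\<rho> x) - ln Z \<le> k x - 1"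
      using pos
    proof eventually_elim
      case (elim x)
      have "ln (k x) \<le> k x - 1"
        using elim \<open>Z > 0\<close> by (intro ln_le_minus_one) (simp add: k_def)
      then show ?case using elim \<open>Z > 0\<close> by (simp add: k_def ln_div ln_mult)
    qed
  qed (use h ent ik in auto)
  moreover have "N.prob (space M) = 1" using N.prob_space by simp
  ultimately show ?thesis
    using k1 h(2) ent ik by (simp add: Z_def)
qed

text \<open>From -\<rho> ln \<rho> \<le> 1 - \<rho> the negative part has integral at most 1, so the
  difference of extended integrals is never \<infinity> - \<infinity>, and it is infinite only
  through the positive part.\<close>

lemma extended_entropy_cases:
  fixes \<rho> :: "'a \<Rightarrow> real"
  assumes M: "prob_space M" and \<rho>: "\<rho> \<in> borel_measurable M" "\<And>x. 0 \<le> \<rho> x"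
    and A: "AE x in density M \<rho>. x \<in> A"
  shows "extended_integral (density M \<rho>) A (\<lambda>x. ln (\<rho> x)) = \<infinity> \<or>
    integrable (density M \<rho>) (\<lambda>x. ln (\<rho> x)) \<and>
    extended_integral (density M \<rho>) A (\<lambda>x. ln (\<rho> x)) = ereal (\<integral>x. ln (\<rho> x) \<partial>density M \<rho>)"
proof -
  let ?N = "density M \<rho>"
  interpret prob_space M by fact
  define P where "P = (\<integral>\<^sup>+x. ennreal (ln (\<rho> x)) \<partial>?N)"
  define Q where "Q = (\<integral>\<^sup>+x. ennreal (- ln (\<rho> x)) \<partial>?N)"
  have [measurable]: "\<rho> \<in> borel_measurable M" by fact
  have eq: "(\<integral>\<^sup>+x\<in>A. f x \<partial>?N) = (\<integral>\<^sup>+x. f x \<partial>?N)" for f :: "'a \<Rightarrow> ennreal"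
    by (rule nn_integral_cong_AE) (use A in eventually_elim, simp)
  have ext: "extended_integral ?N A (\<lambda>x. ln (\<rho> x)) = enn2ereal P - enn2ereal Q"
    unfolding extended_integral_def eq P_def Q_def ..
  have "Q = (\<integral>\<^sup>+x. ennreal (\<rho> x) * ennreal (- ln (\<rho> x)) \<partial>M)"
    unfolding Q_def by (subst nn_integral_density) auto
  also have "\<dots> \<le> (\<integral>\<^sup>+x. 1 \<partial>M)"
  proof (rule nn_integral_mono)
    fix x
    show "ennreal (\<rho> x) * ennreal (- ln (\<rho> x)) \<le> 1"
    proof (cases "\<rho> x = 0")
      case False
      then have r: "\<rho> x > 0" using \<rho>(2)[of x] by simp
      have "- ln (\<rho> x) = ln (1 / \<rho> x)" using r by (simp add: ln_div)
      also have "\<dots> \<le> 1 / \<rho> x - 1" using r by (intro ln_le_minus_one) auto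
      finally have "\<rho> x * (- ln (\<rho> x)) \<le> \<rho> x * (1 / \<rho> x - 1)" using r by (intro mult_left_mono) auto
      also have "\<dots> \<le> 1" using r by (simp add: right_diff_distrib)
      finally have "\<rho> x * (- ln (\<rho> x)) \<le> 1" .
      then have "ennreal (\<rho> x * (- ln (\<rho> x))) \<le> 1" by (metis ennreal_1 ennreal_leI)
      then show ?thesis unfolding ennreal_mult'[OF \<rho>(2)[of x], symmetric] .
    qed simp
  qed
  also have "\<dots> = 1" by (simp add: emeasure_space_1)
  finally have Q: "Q < \<infinity>" by (rule order_le_less_trans) simp
  show ?thesis
  proof (cases "P = \<infinity>")
    case True
    with Q show ?thesis unfolding ext by (cases Q) (auto simp: top_ereal_def)
  next
    case False
    have int: "integrable ?N (\<lambda>x. ln (\<rho> x))"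
      using False Q unfolding real_integrable_def P_def Q_def by auto
    have "(\<integral>x. ln (\<rho> x) \<partial>?N) = enn2real P - enn2real Q"
      unfolding P_def Q_def by (rule real_lebesgue_integral_def[OF int])
    moreover have "enn2ereal P = ereal (enn2real P)" "enn2ereal Q = ereal (enn2real Q)"
      using False Q by (cases P; cases Q; simp add: enn2ereal_ennreal)+
    ultimately show ?thesis using int unfolding ext by simp
  qed
qed

section \<open>Functions of the cell index and the lifting of discrete plans\<close>

lemma nn_integral_cells:
  fixes t :: "'a \<Rightarrow> nat" and h :: "nat \<Rightarrow> ennreal"
  assumes t: "t \<in> measurable M (count_space UNIV)" and B: "finite B" "AE x in M. t x \<in> B"
  shows "(\<integral>\<^sup>+x. h (t x) \<partial>M) = (\<Sum>j\<in>B. h j * emeasure M {x \<in> space M. t x = j})"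
proof -
  have "(\<integral>\<^sup>+x. h (t x) \<partial>M) = (\<integral>\<^sup>+x. (\<Sum>j\<in>B. h j * indicator {x \<in> space M. t x = j} x) \<partial>M)"
  proof (rule nn_integral_cong_AE)
    show "AE x in M. h (t x) = (\<Sum>j\<in>B. h j * indicator {x \<in> space M. t x = j} x)"
      using B(2) AE_space
    proof eventually_elim
      case (elim x)
      then have "(\<Sum>j\<in>B. h j * indicator {x \<in> space M. t x = j} x) = (\<Sum>j\<in>B. if t x = j then h j else 0)"
        by (intro sum.cong) auto
      then show ?case using B(1) elim by simp
    qed
  qed
  also have "\<dots> = (\<Sum>j\<in>B. h j * emeasure M {x \<in> space M. t x = j})"
    using t by (subst nn_integral_sum) (auto intro!: sum.cong nn_integral_cmult_indicator)
  finally show ?thesis .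
qed

lemma (in finite_measure) integral_cells:
  fixes t :: "'a \<Rightarrow> nat" and h :: "nat \<Rightarrow> real"
  assumes t: "t \<in> measurable M (count_space UNIV)" and B: "finite B" "AE x in M. t x \<in> B"
  shows "integrable M (\<lambda>x. h (t x))" "(\<integral>x. h (t x) \<partial>M) = (\<Sum>j\<in>B. h j * measure M {x \<in> space M. t x = j})"
proof -
  let ?s = "\<lambda>x. \<Sum>j\<in>B. h j * indicator {x \<in> space M. t x = j} x"
  have sets: "{x \<in> space M. t x = j} \<in> sets M" for j using t by simp
  have eq: "AE x in M. h (t x) = ?s x"
    using B(2) AE_space
  proof eventually_elim
    case (elim x)
    then have "?s x = (\<Sum>j\<in>B. if t x = j then h j else 0)"
      by (intro sum.cong) auto
    then show ?case using B(1) elim by simp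
  qed
  have m: "(\<lambda>x. h (t x)) \<in> borel_measurable M" "?s \<in> borel_measurable M" using t sets by auto
  have i: "integrable M (indicator {x \<in> space M. t x = j} :: _ \<Rightarrow> real)" for j
    using sets by (simp add: emeasure_eq_measure)
  then have "integrable M ?s" by auto
  then show "integrable M (\<lambda>x. h (t x))"
    by (rule integrable_cong_AE_imp[OF _ m(1)]) (use eq in eventually_elim, simp)
  have "(\<integral>x. h (t x) \<partial>M) = (\<integral>x. ?s x \<partial>M)" by (rule integral_cong_AE[OF m eq])
  also have "\<dots> = (\<Sum>j\<in>B. h j * measure M {x \<in> space M. t x = j})"
    using i sets by (subst Bochner_Integration.integral_sum) (auto intro!: sum.cong)
  finally show "(\<integral>x. h (t x) \<partial>M) = (\<Sum>j\<in>B. h j * measure M {x \<in> space M. t x = j})" .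
qed

text \<open>On the product of cells i and j the coupling is the product measure rescaled by w i j /
  (a i b j). Row and column sums of the plan make the marginals exactly \<nu> and \<mu>, not merely
  their discretisations, while functions of the two cell indices are integrated as by the
  plan.\<close>

lemma coupling_of_discrete_plan:
  fixes \<nu> \<mu> :: "'a::metric_space measure" and t :: "'a \<Rightarrow> nat" and w :: "nat \<Rightarrow> nat \<Rightarrow> real"
  assumes prob: "prob_space \<nu>" "prob_space \<mu>" and sets: "sets \<nu> = sets borel" "sets \<mu> = sets borel"
    and t[measurable]: "t \<in> measurable borel (count_space UNIV)" and fin: "finite A" "finite B"
    and AE: "AE x in \<nu>. t x \<in> A" "AE y in \<mu>. t y \<in> B"
    and a: "\<And>i. i \<in> A \<Longrightarrow> measure \<nu> {x. t x = i} = a i" "\<And>i. i \<in> A \<Longrightarrow> a i > 0"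
    and b: "\<And>j. j \<in> B \<Longrightarrow> measure \<mu> {x. t x = j} = b j" "\<And>j. j \<in> B \<Longrightarrow> b j > 0"
    and w: "\<And>i j. i \<in> A \<Longrightarrow> j \<in> B \<Longrightarrow> w i j \<ge> 0"
      "\<And>i. i \<in> A \<Longrightarrow> (\<Sum>j\<in>B. w i j) = a i" "\<And>j. j \<in> B \<Longrightarrow> (\<Sum>i\<in>A. w i j) = b j"
  obtains \<pi> where "\<pi> \<in> couplings \<nu> \<mu>"
    "\<And>G. (\<integral>\<^sup>+z. G (t (fst z)) (t (snd z)) \<partial>\<pi>) = (\<Sum>i\<in>A. \<Sum>j\<in>B. ennreal (w i j) * G i j)"
proof -
  interpret \<nu>: prob_space \<nu> by fact
  interpret \<mu>: prob_space \<mu> by fact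
  interpret P: pair_sigma_finite \<nu> \<mu> ..
  have sp: "space \<nu> = UNIV" "space \<mu> = UNIV" using sets[THEN sets_eq_imp_space_eq] by simp_all
  note [measurable_cong] = sets
  define d where "d i j = ennreal (w i j / (a i * b j))" for i j
  define \<pi> where "\<pi> = density (\<nu> \<Otimes>\<^sub>M \<mu>) (\<lambda>z. d (t (fst z)) (t (snd z)))"
  have t\<nu>: "t \<in> measurable \<nu> (count_space UNIV)" and t\<mu>: "t \<in> measurable \<mu> (count_space UNIV)" by measurable
  have [measurable]: "(\<lambda>z. H (t (fst z)) (t (snd z))) \<in> borel_measurable (\<nu> \<Otimes>\<^sub>M \<mu>)" for H :: "nat \<Rightarrow> nat \<Rightarrow> ennreal"
    by measurable
  have row: "(\<integral>\<^sup>+y. H (t y) * d i (t y) \<partial>\<mu>) = (\<Sum>j\<in>B. H j * ennreal (w i j / a i))" if "i \<in> A" for i H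
    unfolding nn_integral_cells[OF t\<mu> fin(2) AE(2), of "\<lambda>j. H j * d i j"]
  proof (intro sum.cong refl)
    fix j assume j: "j \<in> B"
    have "d i j * emeasure \<mu> {x \<in> space \<mu>. t x = j} = ennreal (w i j / (a i * b j) * b j)"
      using a(2)[OF that] b[OF j] w(1)[OF that j]
      by (simp add: d_def sp \<mu>.emeasure_eq_measure ennreal_mult[symmetric])
    also have "w i j / (a i * b j) * b j = w i j / a i" using b(2)[OF j] by simp
    finally show "H j * d i j * emeasure \<mu> {x \<in> space \<mu>. t x = j} = H j * ennreal (w i j / a i)"
      by (simp add: mult.assoc)
  qed
  have col: "(\<integral>\<^sup>+x. d (t x) j \<partial>\<nu>) = 1" if j: "j \<in> B" for j
  proof -
    have "(\<integral>\<^sup>+x. d (t x) j \<partial>\<nu>) = (\<Sum>i\<in>A. ennreal (w i j / b j))"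
      unfolding nn_integral_cells[OF t\<nu> fin(1) AE(1), of "\<lambda>i. d i j"]
    proof (intro sum.cong refl)
      fix i assume i: "i \<in> A"
      have "d i j * emeasure \<nu> {x \<in> space \<nu>. t x = i} = ennreal (w i j / (a i * b j) * a i)"
        using a[OF i] b(2)[OF j] w(1)[OF i j]
        by (simp add: d_def sp \<nu>.emeasure_eq_measure ennreal_mult[symmetric])
      also have "w i j / (a i * b j) * a i = w i j / b j" using a(2)[OF i] by simp
      finally show "d i j * emeasure \<nu> {x \<in> space \<nu>. t x = i} = ennreal (w i j / b j)" .
    qed
    also have "\<dots> = ennreal (\<Sum>i\<in>A. w i j / b j)"
      using w(1)[OF _ j] b(2)[OF j] by (intro sum_ennreal) auto
    also have "(\<Sum>i\<in>A. w i j / b j) = 1"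
      using w(3)[OF j] b(2)[OF j] by (simp add: sum_divide_distrib[symmetric])
    finally show ?thesis by simp
  qed
  have row1: "(\<integral>\<^sup>+y. d i (t y) \<partial>\<mu>) = 1" if i: "i \<in> A" for i
  proof -
    have "(\<integral>\<^sup>+y. d i (t y) \<partial>\<mu>) = (\<Sum>j\<in>B. ennreal (w i j / a i))"
      using row[OF i, of "\<lambda>_. 1"] by simp
    also have "\<dots> = ennreal (\<Sum>j\<in>B. w i j / a i)"
      using w(1)[OF i] a(2)[OF i] by (intro sum_ennreal) auto
    also have "(\<Sum>j\<in>B. w i j / a i) = 1"
      using w(2)[OF i] a(2)[OF i] by (simp add: sum_divide_distrib[symmetric])
    finally show ?thesis by simp
  qed
  have "distr \<pi> borel fst = \<nu>"
  proof (rule measure_eqI)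
    fix S assume "S \<in> sets (distr \<pi> borel fst)"
    then have S[measurable]: "S \<in> sets borel" by simp
    have "fst -` S \<in> sets (\<nu> \<Otimes>\<^sub>M \<mu>)"
      using measurable_sets[OF measurable_fst[of \<nu> \<mu>], of S] sets by (simp add: space_pair_measure sp)
    then have "emeasure (distr \<pi> borel fst) S = (\<integral>\<^sup>+z. d (t (fst z)) (t (snd z)) * indicator S (fst z) \<partial>(\<nu> \<Otimes>\<^sub>M \<mu>))"
      unfolding \<pi>_def
      by (subst emeasure_distr, simp, simp, subst emeasure_density)
        (auto intro!: nn_integral_cong simp: indicator_def space_pair_measure sp)
    also have "\<dots> = (\<integral>\<^sup>+x. \<integral>\<^sup>+y. d (t x) (t y) * indicator S x \<partial>\<mu> \<partial>\<nu>)"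
      by (subst \<mu>.nn_integral_fst[symmetric]) auto
    also have "\<dots> = (\<integral>\<^sup>+x. indicator S x \<partial>\<nu>)"
    proof (rule nn_integral_cong_AE)
      show "AE x in \<nu>. (\<integral>\<^sup>+y. d (t x) (t y) * indicator S x \<partial>\<mu>) = indicator S x"
        using AE(1) by eventually_elim (simp add: nn_integral_multc row1)
    qed
    finally show "emeasure (distr \<pi> borel fst) S = emeasure \<nu> S" using sets by simp
  qed (use sets in simp)
  moreover have "distr \<pi> borel snd = \<mu>"
  proof (rule measure_eqI)
    fix S assume "S \<in> sets (distr \<pi> borel snd)"
    then have S[measurable]: "S \<in> sets borel" by simp
    have "snd -` S \<in> sets (\<nu> \<Otimes>\<^sub>M \<mu>)"
      using measurable_sets[OF measurable_snd[of \<nu> \<mu>], of S] sets by (simp add: space_pair_measure sp)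
    then have "emeasure (distr \<pi> borel snd) S = (\<integral>\<^sup>+z. d (t (fst z)) (t (snd z)) * indicator S (snd z) \<partial>(\<nu> \<Otimes>\<^sub>M \<mu>))"
      unfolding \<pi>_def
      by (subst emeasure_distr, simp, simp, subst emeasure_density)
        (auto intro!: nn_integral_cong simp: indicator_def space_pair_measure sp)
    also have "\<dots> = (\<integral>\<^sup>+y. \<integral>\<^sup>+x. d (t x) (t y) * indicator S y \<partial>\<nu> \<partial>\<mu>)"
      by (subst P.nn_integral_snd[symmetric]) auto
    also have "\<dots> = (\<integral>\<^sup>+y. indicator S y \<partial>\<mu>)"
    proof (rule nn_integral_cong_AE)
      show "AE y in \<mu>. (\<integral>\<^sup>+x. d (t x) (t y) * indicator S y \<partial>\<nu>) = indicator S y"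
        using AE(2) by eventually_elim (simp add: nn_integral_multc col)
    qed
    finally show "emeasure (distr \<pi> borel snd) S = emeasure \<mu> S" using sets by simp
  qed (use sets in simp)
  moreover have sets\<pi>: "sets \<pi> = sets (borel \<Otimes>\<^sub>M borel)"
    unfolding \<pi>_def using sets by (simp cong: sets_pair_measure_cong)
  moreover have "prob_space \<pi>"
  proof (rule prob_spaceI)
    have "emeasure \<pi> (space \<pi>) = emeasure (distr \<pi> borel fst) UNIV"
      using sets\<pi> by (subst emeasure_distr) (auto simp: measurable_cong_sets[OF sets\<pi> refl])
    also have "\<dots> = 1" using \<open>distr \<pi> borel fst = \<nu>\<close> \<nu>.emeasure_space_1 sp by simp
    finally show "emeasure \<pi> (space \<pi>) = 1" .
  qed
  ultimately have "\<pi> \<in> couplings \<nu> \<mu>" by (simp add: couplings_def)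
  moreover have "(\<integral>\<^sup>+z. G (t (fst z)) (t (snd z)) \<partial>\<pi>) = (\<Sum>i\<in>A. \<Sum>j\<in>B. ennreal (w i j) * G i j)" for G
  proof -
    have "(\<integral>\<^sup>+z. G (t (fst z)) (t (snd z)) \<partial>\<pi>) =
        (\<integral>\<^sup>+z. d (t (fst z)) (t (snd z)) * G (t (fst z)) (t (snd z)) \<partial>(\<nu> \<Otimes>\<^sub>M \<mu>))"
      unfolding \<pi>_def by (rule nn_integral_density) auto
    also have "\<dots> = (\<integral>\<^sup>+x. \<integral>\<^sup>+y. d (t x) (t y) * G (t x) (t y) \<partial>\<mu> \<partial>\<nu>)"
      by (subst \<mu>.nn_integral_fst[symmetric]) auto
    also have "\<dots> = (\<integral>\<^sup>+x. (\<Sum>j\<in>B. G (t x) j * ennreal (w (t x) j / a (t x))) \<partial>\<nu>)"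
    proof (rule nn_integral_cong_AE)
      show "AE x in \<nu>. (\<integral>\<^sup>+y. d (t x) (t y) * G (t x) (t y) \<partial>\<mu>) = (\<Sum>j\<in>B. G (t x) j * ennreal (w (t x) j / a (t x)))"
        using AE(1) by eventually_elim (simp add: row mult.commute[of "d _ _"])
    qed
    also have "\<dots> = (\<Sum>i\<in>A. (\<Sum>j\<in>B. G i j * ennreal (w i j / a i)) * emeasure \<nu> {x \<in> space \<nu>. t x = i})"
      by (rule nn_integral_cells[OF t\<nu> fin(1) AE(1)])
    also have "\<dots> = (\<Sum>i\<in>A. \<Sum>j\<in>B. ennreal (w i j) * G i j)"
      unfolding sum_distrib_right
    proof (intro sum.cong refl)
      fix i j assume i: "i \<in> A" and j: "j \<in> B"
      have "ennreal (w i j / a i) * emeasure \<nu> {x \<in> space \<nu>. t x = i} = ennreal (w i j / a i * a i)"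
        using a[OF i] w(1)[OF i j] by (simp add: sp \<nu>.emeasure_eq_measure ennreal_mult[symmetric])
      also have "w i j / a i * a i = w i j" using a(2)[OF i] by simp
      finally show "G i j * ennreal (w i j / a i) * emeasure \<nu> {x \<in> space \<nu>. t x = i} = ennreal (w i j) * G i j"
        by (simp add: mult.assoc mult.commute)
    qed
    finally show ?thesis .
  qed
  ultimately show thesis by (rule that)
qed

section \<open>From the logarithmic Sobolev inequality to the transportation cost\<close>

text \<open>Multiply by 1 - z: exp z (1 - z) \<le> 1, while (1 + z + 2 z^2) (1 - z) = 1 + z^2 (1 - 2
  z), which is at least 1 for z \<le> 1/2. It makes the small-time expansion of the exponential
  moment quantitative.\<close>

lemma exp_le_quadratic:
  fixes z :: real
  assumes "\<bar>z\<bar> \<le> 1 / 2"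
  shows "exp z \<le> 1 + z + 2 * z\<^sup>2"
proof -
  have pos: "0 < 1 - z" using assms by linarith
  have "1 - z \<le> exp (- z)" using exp_ge_add_one_self[of "- z"] by simp
  then have "exp z * (1 - z) \<le> exp z * exp (- z)" by (intro mult_left_mono) auto
  also have "\<dots> = 1" by (simp add: exp_minus)
  also have "1 \<le> (1 + z + 2 * z\<^sup>2) * (1 - z)"
  proof -
    have "(1 + z + 2 * z\<^sup>2) * (1 - z) = 1 + z\<^sup>2 * (1 - 2 * z)"
      by (simp add: algebra_simps power2_eq_square)
    moreover have "0 \<le> z\<^sup>2 * (1 - 2 * z)" using assms by (intro mult_nonneg_nonneg) auto
    ultimately show ?thesis by linarith
  qed
  finally show ?thesis using pos by simp
qed

context log_sobolev_space
begin

text \<open>Monotonicity compares time 1 with time s. At time s the cell centre of x is a candidate,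
  giving v \<le> \<phi> (t x) + \<epsilon>^2 / (2 s); the quadratic bound on exp then leaves the
  mean of \<phi> plus an error 2 (\<alpha> s C)^2 before division by \<alpha> s.\<close>

lemma hopf_lax_exp_bound:
  fixes J :: "nat set" and \<phi> :: "nat \<Rightarrow> real" and y :: "nat \<Rightarrow> 'a" and t :: "'a \<Rightarrow> nat"
  assumes J: "finite J" "J \<noteq> {}" and \<eta>: "\<eta> > 0"
    and D: "\<And>x j. x \<in> K \<Longrightarrow> j \<in> J \<Longrightarrow> dist x (y j) \<le> D"
    and C: "\<And>j. j \<in> J \<Longrightarrow> \<bar>\<phi> j\<bar> \<le> C"
    and t: "t \<in> measurable M (count_space UNIV)" "AE x in M. t x \<in> J \<and> dist x (y (t x)) \<le> \<epsilon>"
    and s: "0 < s" "s \<le> 1" "\<alpha> * s * C \<le> 1 / 2"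
  shows "ln (\<integral>x. exp (\<alpha> * hopf_lax J \<phi> y \<eta> 1 x) \<partial>M) / \<alpha> \<le> (\<integral>x. \<phi> (t x) \<partial>M) + 2 * \<alpha> * s * C\<^sup>2 + \<epsilon>\<^sup>2 / (2 * s)"
proof -
  let ?v = "hopf_lax J \<phi> y \<eta>" and ?I = "{s / 2<..<2}"
  have C0: "0 \<le> C" using C J(2) by force
  have tJ: "AE x in M. t x \<in> J" using t(2) by eventually_elim simp
  \<comment> \<open>For times above s / 2 the kernel is at most D^2 / s and its time derivative at
    most 2 D^2 / s^2 in absolute value; the middle term is the smoothing loss. \<open>R\<close> need
    not be small, it only supplies a uniform bound.\<close>
  define R where "R = D\<^sup>2 / s + \<eta> * ln (card J) + 2 * D\<^sup>2 / s\<^sup>2"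
  have lncard: "0 \<le> \<eta> * ln (card J)"
  proof (intro mult_nonneg_nonneg ln_ge_zero)
    have "card J > 0" using J by (simp add: card_gt_0_iff)
    then show "1 \<le> real (card J)" by linarith
  qed (use \<eta> in simp)
  have sq: "(x - y j) \<bullet> (x - y j) \<le> D\<^sup>2" if "x \<in> K" "j \<in> J" for x j
    using D[OF that] by (simp add: dist_norm power2_norm_eq_inner[symmetric] power_mono)
  have vB: "\<bar>?v \<tau> x\<bar> \<le> C + R" if \<tau>: "\<tau> \<in> ?I" and x: "x \<in> K" for \<tau> x
  proof -
    have \<tau>0: "\<tau> > 0" using \<tau> s by simp
    have "0 \<le> (x - y j) \<bullet> (x - y j) / (2 * \<tau>)" for j using \<tau>0 by simp
    then have "- C \<le> \<phi> j + (x - y j) \<bullet> (x - y j) / (2 * \<tau>)" if "j \<in> J" for j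
      using C[OF that] by (smt (verit))
    then have "- C - \<eta> * ln (card J) \<le> ?v \<tau> x"
      by (rule hopf_lax_ge[OF J \<eta>])
    moreover obtain j where j: "j \<in> J" using J by blast
    have "?v \<tau> x \<le> \<phi> j + (x - y j) \<bullet> (x - y j) / (2 * \<tau>)"
      by (rule hopf_lax_le[OF J \<eta> j])
    moreover have "(x - y j) \<bullet> (x - y j) / (2 * \<tau>) \<le> D\<^sup>2 / s"
      using \<tau> by (intro frac_le sq[OF x j] s(1)) auto
    moreover have "0 \<le> D\<^sup>2 / s" "0 \<le> 2 * D\<^sup>2 / s\<^sup>2" using s by auto
    ultimately show ?thesis using C[OF j] lncard unfolding R_def by linarith
  qed
  have dB: "\<bar>hopf_lax_dt J \<phi> y \<eta> \<tau> x\<bar> \<le> C + R" if \<tau>: "\<tau> \<in> ?I" and x: "x \<in> K" for \<tau> x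
  proof -
    let ?p = "hopf_lax_weight J \<phi> y \<eta> \<tau> x"
    have \<tau>0: "\<tau> > 0" using \<tau> s by simp
    have "0 \<le> (\<Sum>j\<in>J. ?p j * ((x - y j) \<bullet> (x - y j) / (2 * \<tau>\<^sup>2)))"
      by (intro sum_nonneg mult_nonneg_nonneg hopf_lax_weight_nonneg[OF J \<eta>]) auto
    moreover have "(\<Sum>j\<in>J. ?p j * ((x - y j) \<bullet> (x - y j) / (2 * \<tau>\<^sup>2))) \<le> (\<Sum>j\<in>J. ?p j * (2 * D\<^sup>2 / s\<^sup>2))"
    proof (intro sum_mono mult_left_mono hopf_lax_weight_nonneg[OF J \<eta>])
      fix j assume j: "j \<in> J"
      have "s\<^sup>2 / 4 \<le> \<tau>\<^sup>2"
        using power_mono[of "s / 2" \<tau> 2] \<tau> s by (simp add: power_divide)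
      then have "(x - y j) \<bullet> (x - y j) / (2 * \<tau>\<^sup>2) \<le> D\<^sup>2 / (2 * (s\<^sup>2 / 4))"
        using sq[OF x j] s by (intro frac_le) auto
      then show "(x - y j) \<bullet> (x - y j) / (2 * \<tau>\<^sup>2) \<le> 2 * D\<^sup>2 / s\<^sup>2" by simp
    qed
    moreover have "(\<Sum>j\<in>J. ?p j * (2 * D\<^sup>2 / s\<^sup>2)) = 2 * D\<^sup>2 / s\<^sup>2"
      unfolding sum_distrib_right[symmetric] sum_hopf_lax_weight[OF J \<eta>] by simp
    moreover have "0 \<le> D\<^sup>2 / s" using s by auto
    ultimately show ?thesis unfolding hopf_lax_dt_def R_def using lncard C0 by linarith
  qed
  \<comment> \<open>The open interval from s / 2 to 2 contains s and 1 and stays away from the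
    singular time 0.\<close>
  have mono: "ln (\<integral>x. exp (\<alpha> * 1 * ?v 1 x) \<partial>M) / (\<alpha> * 1) \<le> ln (\<integral>x. exp (\<alpha> * s * ?v s x) \<partial>M) / (\<alpha> * s)"
  proof (rule hopf_cole_antimono[where l="s / 2" and u=2 and gr="hopf_lax_grad J \<phi> y \<eta>"
        and vt="hopf_lax_dt J \<phi> y \<eta>" and B="C + R"])
    fix \<tau> x assume "\<tau> \<in> ?I"
    then have "\<tau> > 0" using s by simp
    then show "(?v \<tau> has_derivative (\<lambda>h. hopf_lax_grad J \<phi> y \<eta> \<tau> x \<bullet> h)) (at x)"
      "((\<lambda>t. ?v t x) has_real_derivative hopf_lax_dt J \<phi> y \<eta> \<tau> x) (at \<tau>)"
      "hopf_lax_dt J \<phi> y \<eta> \<tau> x + (norm (hopf_lax_grad J \<phi> y \<eta> \<tau> x))\<^sup>2 / 2 \<le> 0"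
      by (rule has_derivative_hopf_lax[OF J \<eta>] has_real_derivative_hopf_lax[OF J \<eta>] hopf_lax_subsolution[OF J \<eta>])+
  qed (use s vB dB continuous_on_hopf_lax_grad[OF J \<eta>] continuous_on_hopf_lax_dt[OF J \<eta>] in auto)
  define b where "b = (\<integral>x. \<phi> (t x) \<partial>M)"
  let ?a = "\<alpha> * s"
  have a: "?a > 0" using \<alpha>_pos s by simp
  have vcont: "continuous_on UNIV (?v s)"
    using has_derivative_hopf_lax[OF J \<eta> s(1)] by (meson has_derivative_continuous continuous_at_imp_continuous_on)
  have i0: "integrable M (\<lambda>x. exp (?a * ?v s x))"
  proof (rule integrable_bounded_on[where C="exp (?a * (C + R))"])
    show "(\<lambda>x. exp (?a * ?v s x)) \<in> borel_measurable M"
      by (intro continuous_measurable continuous_on_exp continuous_on_mult_left vcont)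
    show "\<bar>exp (?a * ?v s x)\<bar> \<le> exp (?a * (C + R))" if "x \<in> K" for x
    proof -
      have "?v s x \<le> C + R" using vB[OF _ that, of s] s by auto
      then have "?a * ?v s x \<le> ?a * (C + R)" using a by (intro mult_left_mono) auto
      then show ?thesis by simp
    qed
  qed
  have i1: "integrable M (\<lambda>x. \<phi> (t x))" by (rule integral_cells(1)[OF t(1) J(1) tJ])
  have "(\<integral>x. exp (?a * ?v s x) \<partial>M) \<le> (\<integral>x. exp (?a * (\<epsilon>\<^sup>2 / (2 * s))) * (1 + ?a * \<phi> (t x) + 2 * (?a * C)\<^sup>2) \<partial>M)"
  proof (rule integral_mono_AE[OF i0])
    show "AE x in M. exp (?a * ?v s x) \<le> exp (?a * (\<epsilon>\<^sup>2 / (2 * s))) * (1 + ?a * \<phi> (t x) + 2 * (?a * C)\<^sup>2)"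
      using t(2)
    proof eventually_elim
      case (elim x)
      then have j: "t x \<in> J" by simp
      have "(x - y (t x)) \<bullet> (x - y (t x)) \<le> \<epsilon>\<^sup>2"
        using elim by (simp add: dist_norm power2_norm_eq_inner[symmetric] power_mono)
      then have "(x - y (t x)) \<bullet> (x - y (t x)) / (2 * s) \<le> \<epsilon>\<^sup>2 / (2 * s)"
        using s by (intro divide_right_mono) auto
      then have "?v s x \<le> \<phi> (t x) + \<epsilon>\<^sup>2 / (2 * s)"
        using hopf_lax_le[OF J \<eta> j, of \<phi> y s x] by linarith
      then have "?a * ?v s x \<le> ?a * (\<phi> (t x) + \<epsilon>\<^sup>2 / (2 * s))" using a by (intro mult_left_mono) auto
      then have "exp (?a * ?v s x) \<le> exp (?a * (\<phi> (t x) + \<epsilon>\<^sup>2 / (2 * s)))" by simp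
      also have "\<dots> = exp (?a * (\<epsilon>\<^sup>2 / (2 * s))) * exp (?a * \<phi> (t x))"
        by (simp only: distrib_left exp_add mult.commute)
      finally have 1: "exp (?a * ?v s x) \<le> exp (?a * (\<epsilon>\<^sup>2 / (2 * s))) * exp (?a * \<phi> (t x))" .
      have z: "\<bar>?a * \<phi> (t x)\<bar> \<le> ?a * C"
        unfolding abs_mult[of ?a] using C[OF j] a by (simp add: mult_left_mono)
      have "exp (?a * \<phi> (t x)) \<le> 1 + ?a * \<phi> (t x) + 2 * (?a * \<phi> (t x))\<^sup>2"
        using z s(3) by (intro exp_le_quadratic) linarith
      also have "\<dots> \<le> 1 + ?a * \<phi> (t x) + 2 * (?a * C)\<^sup>2"
        using power_mono[OF z, of 2] by simp
      finally have "exp (?a * \<phi> (t x)) \<le> 1 + ?a * \<phi> (t x) + 2 * (?a * C)\<^sup>2" .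
      then show ?case using 1 by (meson exp_ge_zero mult_left_mono order_trans)
    qed
  qed (use i1 in auto)
  also have "\<dots> = exp (?a * (\<epsilon>\<^sup>2 / (2 * s))) * (1 + ?a * b + 2 * (?a * C)\<^sup>2)"
    using i1 prob_space by (simp add: b_def)
  \<comment> \<open>Returning to an exponential by 1 + z \<le> exp z lets the logarithm be taken
    without any further error.\<close>
  also have "\<dots> \<le> exp (?a * (\<epsilon>\<^sup>2 / (2 * s))) * exp (?a * b + 2 * (?a * C)\<^sup>2)"
    using exp_ge_add_one_self[of "?a * b + 2 * (?a * C)\<^sup>2"]
    by (intro mult_left_mono) (simp_all only: add.assoc exp_ge_zero)
  also have "\<dots> = exp (?a * (b + 2 * ?a * C\<^sup>2 + \<epsilon>\<^sup>2 / (2 * s)))"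
  proof -
    have "p * q + (p * b + 2 * (p * C)\<^sup>2) = p * (b + 2 * p * C\<^sup>2 + q)" for p q :: real
      by (simp add: algebra_simps power2_eq_square)
    then show ?thesis by (simp only: exp_add[symmetric])
  qed
  finally have le: "(\<integral>x. exp (?a * ?v s x) \<partial>M) \<le> exp (?a * (b + 2 * ?a * C\<^sup>2 + \<epsilon>\<^sup>2 / (2 * s)))" .
  have pos: "0 < (\<integral>x. exp (?a * ?v s x) \<partial>M)"
  proof (rule expectation_pos_bounded_on[OF i0])
    show "exp (- (?a * (C + R))) \<le> exp (?a * ?v s x)" if "x \<in> K" for x
    proof -
      have "- (C + R) \<le> ?v s x" using vB[OF _ that, of s] s by auto
      then have "?a * - (C + R) \<le> ?a * ?v s x" using a by (intro mult_left_mono) auto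
      then show ?thesis by (simp only: exp_le_cancel_iff mult_minus_right)
    qed
  qed simp
  have "ln (\<integral>x. exp (?a * ?v s x) \<partial>M) \<le> ?a * (b + 2 * ?a * C\<^sup>2 + \<epsilon>\<^sup>2 / (2 * s))"
    using ln_mono[OF le pos] unfolding ln_exp .
  then have "ln (\<integral>x. exp (?a * ?v s x) \<partial>M) / ?a \<le> b + 2 * ?a * C\<^sup>2 + \<epsilon>\<^sup>2 / (2 * s)"
    unfolding pos_divide_le_eq[OF a] by (subst mult.commute)
  then show ?thesis using mono by (simp add: b_def)
qed

text \<open>A finite net of the compact set gives the centres; a point belongs to the cell of the
  first centre within distance \<epsilon>, which keeps the cells disjoint and Borel.\<close>

lemma compact_cells:
  assumes "0 < \<epsilon>"
  shows "\<exists>(n :: nat) (y :: nat \<Rightarrow> 'a) t. (\<forall>i<n. y i \<in> K) \<and> t \<in> measurable borel (count_space UNIV)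
    \<and> (\<forall>x\<in>K. t x < n \<and> dist x (y (t x)) \<le> \<epsilon>)"
proof -
  obtain k where k: "finite k" "k \<subseteq> K" "K \<subseteq> (\<Union>x\<in>k. ball x \<epsilon>)"
    using compactE_image[OF compact_K, of K "\<lambda>x. ball x \<epsilon>"] assms by force
  obtain y :: "nat \<Rightarrow> 'a" where y: "bij_betw y {..<card k} k"
    using ex_bij_betw_nat_finite[OF k(1)] by (auto simp: lessThan_atLeast0)
  define n where "n = card k"
  \<comment> \<open>The extra index \<open>n\<close> collects the points far from all centres, so
    the least index always exists.\<close>
  define t where "t x = (LEAST i. i < n \<and> dist x (y i) \<le> \<epsilon> \<or> i = n)" for x
  have "t \<in> measurable borel (count_space UNIV)"
    unfolding t_def
  proof (rule measurable_Least)
    fix i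
    have "{x. i < n \<and> dist x (y i) \<le> \<epsilon> \<or> i = n} \<in> sets borel"
      by (intro borel_closed closed_Collect_disj closed_Collect_conj closed_Collect_const closed_Collect_le continuous_intros)
    then show "(\<lambda>x. i < n \<and> dist x (y i) \<le> \<epsilon> \<or> i = n) \<in> measurable borel (count_space UNIV)"
      unfolding pred_def space_borel by (simp only: UNIV_I simp_thms)
  qed
  moreover have "t x < n \<and> dist x (y (t x)) \<le> \<epsilon>" if x: "x \<in> K" for x
  proof -
    obtain z where z: "z \<in> k" "dist z x < \<epsilon>" using subsetD[OF k(3) x] by auto
    then have "z \<in> y ` {..<n}" using y by (simp only: n_def bij_betw_def)
    then obtain i where i: "i < n" "y i = z" by auto
    then have Pi: "i < n \<and> dist x (y i) \<le> \<epsilon> \<or> i = n" using z by (auto simp: dist_commute)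
    have "t x \<le> i" unfolding t_def by (rule Least_le[of "\<lambda>i. i < n \<and> dist x (y i) \<le> \<epsilon> \<or> i = n", OF Pi])
    moreover have "t x < n \<and> dist x (y (t x)) \<le> \<epsilon> \<or> t x = n"
      unfolding t_def by (rule LeastI[of "\<lambda>i. i < n \<and> dist x (y i) \<le> \<epsilon> \<or> i = n", OF Pi])
    ultimately show ?thesis using i by auto
  qed
  moreover have "y i \<in> K" if "i < n" for i
    using bij_betwE[OF y] that k(2) by (auto simp: n_def)
  ultimately show ?thesis by blast
qed

text \<open>The cost between centres is at most the dual value plus \<epsilon>. Up to small errors g
  lies below the soft minimum v at time 1, whose mean under N is controlled by entropy and
  exponential moment; the Hopf--Lax bound for that moment produces the mean of f under M, which
  cancels against the dual value.\<close>

lemma near_optimal_coupling: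
  fixes \<rho> :: "'a \<Rightarrow> real"
  defines "N \<equiv> density M (\<lambda>x. ennreal (\<rho> x))"
  assumes \<rho>: "\<rho> \<in> borel_measurable M" "\<And>x. 0 \<le> \<rho> x" and N: "prob_space N"
    and ent: "integrable N (\<lambda>x. ln (\<rho> x))"
    and D: "0 \<le> D" "\<And>x y. x \<in> K \<Longrightarrow> y \<in> K \<Longrightarrow> dist x y \<le> D"
    and \<epsilon>: "0 < \<epsilon>" "\<epsilon> \<le> 1" "\<alpha> * \<epsilon> * (D\<^sup>2 / 2) \<le> 1 / 2"
  shows "\<exists>\<pi>\<in>couplings N M. (\<integral>\<^sup>+z. ennreal ((dist (fst z) (snd z))\<^sup>2) \<partial>\<pi>)
    \<le> ennreal (2 / \<alpha> * (\<integral>x. ln (\<rho> x) \<partial>N) + \<epsilon> * (\<alpha> * D ^ 4 + 6 * D + 12))"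
proof -
  interpret N: prob_space N by fact
  have setsN: "sets N = sets borel" using sets_eq by (simp add: N_def)
  have spN: "space N = UNIV" by (simp add: N_def)
  have AE_KN: "AE x in N. x \<in> K"
    unfolding N_def using AE_K by (subst AE_density) (use \<rho> in auto)
  obtain n :: nat and y :: "nat \<Rightarrow> 'a" and t :: "'a \<Rightarrow> nat" where yK: "\<And>i. i < n \<Longrightarrow> y i \<in> K"
    and t: "t \<in> measurable borel (count_space UNIV)"
    and tK: "\<And>x. x \<in> K \<Longrightarrow> t x < n \<and> dist x (y (t x)) \<le> \<epsilon>"
    using compact_cells[OF \<epsilon>(1)] by metis
  have tM: "t \<in> measurable M (count_space UNIV)" and tN: "t \<in> measurable N (count_space UNIV)"
    using t measurable_cong_sets[OF sets_eq refl] measurable_cong_sets[OF setsN refl] by blast+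
  define a where "a i = measure N {x. t x = i}" for i
  define b where "b i = measure M {x. t x = i}" for i
  \<comment> \<open>Cells of mass zero are discarded, since duality is applied with strictly
    positive masses.\<close>
  define A where "A = {i. i < n \<and> 0 < a i}"
  define B where "B = {i. i < n \<and> 0 < b i}"
  have fin: "finite A" "finite B" by (simp_all add: A_def B_def)
  have cells: "{x. t x = i} \<in> sets borel" for i
    using measurable_sets[OF t, of "{i}"] by (simp add: vimage_def)
  have AEN: "AE x in N. t x \<in> A"
  proof -
    have "AE x in N. \<forall>i\<in>{..<n} - A. t x \<noteq> i"
    proof (rule AE_finite_allI)
      fix i assume "i \<in> {..<n} - A"
      then have "measure N {x. t x = i} = 0"
        using measure_nonneg[of N "{x. t x = i}"] by (simp add: A_def a_def)
      then show "AE x in N. t x \<noteq> i"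
        using cells[of i] setsN by (intro AE_I[of _ _ "{x. t x = i}"]) (auto simp: N.emeasure_eq_measure)
    qed simp
    with AE_KN show ?thesis
      by eventually_elim (use tK in blast)
  qed
  have AEM: "AE x in M. t x \<in> B"
  proof -
    have "AE x in M. \<forall>i\<in>{..<n} - B. t x \<noteq> i"
    proof (rule AE_finite_allI)
      fix i assume "i \<in> {..<n} - B"
      then have "measure M {x. t x = i} = 0"
        using measure_nonneg[of M "{x. t x = i}"] by (simp add: B_def b_def)
      then show "AE x in M. t x \<noteq> i"
        using cells[of i] sets_eq by (intro AE_I[of _ _ "{x. t x = i}"]) (auto simp: emeasure_eq_measure)
    qed simp
    with AE_K show ?thesis
      by eventually_elim (use tK in blast)
  qed
  have Nint: "(\<integral>x. h (t x) \<partial>N) = (\<Sum>i\<in>A. h i * a i)" for h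
    using N.integral_cells(2)[OF tN fin(1) AEN, of h] by (simp add: a_def spN)
  have Mint: "(\<integral>x. h (t x) \<partial>M) = (\<Sum>i\<in>B. h i * b i)" for h
    using integral_cells(2)[OF tM fin(2) AEM, of h] by (simp add: b_def)
  have one: "sum a A = 1" "sum b B = 1"
    using Nint[of "\<lambda>_. 1"] Mint[of "\<lambda>_. 1"] N.prob_space prob_space by simp_all
  have neB: "B \<noteq> {}" using one by auto
  \<comment> \<open>Half the squared distance is the Hopf--Lax kernel at time 1; the factor 2
    returns when the coupling is evaluated.\<close>
  define c where "c i j = (dist (y i) (y j))\<^sup>2 / 2" for i j
  have c: "0 \<le> c i j \<and> c i j \<le> D\<^sup>2 / 2" if "i \<in> A" "j \<in> B" for i j
    using D(2)[OF yK yK, of i j] that by (auto simp: c_def A_def B_def intro!: power_mono)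
  have apos: "\<And>i. i \<in> A \<Longrightarrow> 0 < a i" and bpos: "\<And>j. j \<in> B \<Longrightarrow> 0 < b j" by (simp_all add: A_def B_def)
  obtain w g f where w: "\<And>i j. i \<in> A \<Longrightarrow> j \<in> B \<Longrightarrow> w i j \<ge> 0"
    "\<And>i. i \<in> A \<Longrightarrow> (\<Sum>j\<in>B. w i j) = a i" "\<And>j. j \<in> B \<Longrightarrow> (\<Sum>i\<in>A. w i j) = b j"
    and gf: "\<And>i j. i \<in> A \<Longrightarrow> j \<in> B \<Longrightarrow> g i - f j \<le> c i j" and f: "\<And>j. j \<in> B \<Longrightarrow> \<bar>f j\<bar> \<le> D\<^sup>2 / 2"
    and dual: "(\<Sum>i\<in>A. \<Sum>j\<in>B. w i j * c i j) \<le> (\<Sum>i\<in>A. g i * a i) - (\<Sum>j\<in>B. f j * b j) + \<epsilon>"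
    by (rule finite_transport_duality_bounded[OF fin apos bpos one \<epsilon>(1) c]) blast+
  \<comment> \<open>Chosen so that the smoothing loss \<eta> ln |B| is at most \<epsilon>; the
    summand 1 covers the case of a single cell, where the logarithm is 0.\<close>
  define \<eta> where "\<eta> = \<epsilon> / (1 + ln (card B))"
  have lncard: "0 \<le> ln (card B)"
  proof (rule ln_ge_zero)
    have "card B > 0" using neB fin by (simp add: card_gt_0_iff)
    then show "1 \<le> real (card B)" by linarith
  qed
  have \<eta>: "\<eta> > 0" using \<epsilon> lncard by (simp add: \<eta>_def)
  have \<eta>_ln: "\<eta> * ln (card B) \<le> \<epsilon>"
    using \<epsilon> lncard by (simp add: \<eta>_def divide_le_eq)
  let ?v = "hopf_lax B f y \<eta> 1"
  define H where "H = (\<integral>x. ln (\<rho> x) \<partial>N)"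
  have yD: "dist x (y j) \<le> D" if "x \<in> K" "j \<in> B" for x j
    using D(2)[OF that(1) yK] that(2) by (simp add: B_def)
  have v_le: "?v x \<le> D\<^sup>2 / 2 + D\<^sup>2 / 2" and v_ge: "- (D\<^sup>2 / 2) - \<eta> * ln (card B) \<le> ?v x" if x: "x \<in> K" for x
  proof -
    have sq: "0 \<le> (x - y j) \<bullet> (x - y j) \<and> (x - y j) \<bullet> (x - y j) \<le> D\<^sup>2" if "j \<in> B" for j
      using yD[OF x that] by (simp add: dist_norm power2_norm_eq_inner[symmetric] power_mono)
    obtain j where j: "j \<in> B" using neB by blast
    show "?v x \<le> D\<^sup>2 / 2 + D\<^sup>2 / 2"
      using hopf_lax_le[OF fin(2) neB \<eta> j, of f y 1 x] sq[OF j] f[OF j] by (simp add: abs_le_iff)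
    show "- (D\<^sup>2 / 2) - \<eta> * ln (card B) \<le> ?v x"
    proof (rule hopf_lax_ge[OF fin(2) neB \<eta>])
      fix j assume j: "j \<in> B"
      show "- (D\<^sup>2 / 2) \<le> f j + (x - y j) \<bullet> (x - y j) / (2 * 1)"
      proof -
        have "0 \<le> (x - y j) \<bullet> (x - y j) / (2 * 1)" by simp
        moreover have "- (D\<^sup>2 / 2) \<le> f j" using f[OF j] by linarith
        ultimately show ?thesis by linarith
      qed
    qed
  qed
  have vcont: "continuous_on UNIV ?v"
    using has_derivative_hopf_lax[OF fin(2) neB \<eta>, of 1] by (meson has_derivative_continuous continuous_at_imp_continuous_on zero_less_one)
  then have vmeas: "?v \<in> borel_measurable M" by (rule continuous_measurable)
  have vbd: "\<bar>?v x\<bar> \<le> D\<^sup>2 + \<epsilon>" if "x \<in> K" for x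
    using v_le[OF that] v_ge[OF that] \<eta>_ln zero_le_power2[of D] \<epsilon>(1) unfolding abs_le_iff by linarith
  have vN: "integrable N ?v"
  proof (rule N.integrable_const_bound[where B="D\<^sup>2 + \<epsilon>"])
    show "AE x in N. norm (?v x) \<le> D\<^sup>2 + \<epsilon>" using AE_KN by eventually_elim (use vbd in simp)
    show "?v \<in> borel_measurable N" using vmeas by (simp add: N_def)
  qed
  have expv: "integrable M (\<lambda>x. exp (\<alpha> * ?v x))"
  proof (rule integrable_bounded_on[where C="exp (\<alpha> * (D\<^sup>2 + \<epsilon>))"])
    show "(\<lambda>x. exp (\<alpha> * ?v x)) \<in> borel_measurable M" using vmeas by measurable
    show "\<bar>exp (\<alpha> * ?v x)\<bar> \<le> exp (\<alpha> * (D\<^sup>2 + \<epsilon>))" if "x \<in> K" for x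
      using vbd[OF that] \<alpha>_pos by (simp add: abs_le_iff)
  qed
  \<comment> \<open>Dual feasibility holds at the centre of the cell of x. Moving from that centre
    to x changes the kernel by at most \<epsilon> D + \<epsilon>^2 / 2, and the last term is the
    smoothing loss.\<close>
  have g_le: "g (t x) \<le> ?v x + \<epsilon> * D + \<epsilon>\<^sup>2 / 2 + \<eta> * ln (card B)" if x: "x \<in> K" "t x \<in> A" for x
  proof -
    have "g (t x) - \<epsilon> * D - \<epsilon>\<^sup>2 / 2 - \<eta> * ln (card B) \<le> ?v x"
    proof (rule hopf_lax_ge[OF fin(2) neB \<eta>])
      fix j assume j: "j \<in> B"
      have "dist (y (t x)) (y j) \<le> dist x (y j) + \<epsilon>"
        using tK[OF x(1)] dist_triangle[of "y (t x)" "y j" x] by (simp add: dist_commute)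
      then have "(dist (y (t x)) (y j))\<^sup>2 \<le> (dist x (y j) + \<epsilon>)\<^sup>2" by (intro power_mono) auto
      also have "\<dots> = (dist x (y j))\<^sup>2 + 2 * (\<epsilon> * dist x (y j)) + \<epsilon>\<^sup>2"
        by (simp add: power2_sum)
      also have "\<epsilon> * dist x (y j) \<le> \<epsilon> * D" using yD[OF x(1) j] \<epsilon> by simp
      finally have "c (t x) j \<le> (dist x (y j))\<^sup>2 / 2 + \<epsilon> * D + \<epsilon>\<^sup>2 / 2"
        unfolding c_def by linarith
      moreover have "(dist x (y j))\<^sup>2 = (x - y j) \<bullet> (x - y j)"
        by (simp add: dist_norm power2_norm_eq_inner)
      ultimately show "g (t x) - \<epsilon> * D - \<epsilon>\<^sup>2 / 2 \<le> f j + (x - y j) \<bullet> (x - y j) / (2 * 1)"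
        using gf[OF x(2) j] by simp
    qed
    then show ?thesis by linarith
  qed
  have "(\<Sum>i\<in>A. g i * a i) = (\<integral>x. g (t x) \<partial>N)" by (simp add: Nint)
  also have "\<dots> \<le> (\<integral>x. ?v x + (\<epsilon> * D + \<epsilon>\<^sup>2 / 2 + \<eta> * ln (card B)) \<partial>N)"
  proof (intro integral_mono_AE)
    show "integrable N (\<lambda>x. g (t x))" by (rule N.integral_cells(1)[OF tN fin(1) AEN])
    show "AE x in N. g (t x) \<le> ?v x + (\<epsilon> * D + \<epsilon>\<^sup>2 / 2 + \<eta> * ln (card B))"
      using AE_KN AEN by eventually_elim (use g_le in \<open>simp add: add.assoc\<close>)
  qed (use vN in simp)
  also have "\<dots> = (\<integral>x. ?v x \<partial>N) + (\<epsilon> * D + \<epsilon>\<^sup>2 / 2 + \<eta> * ln (card B))"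
    using vN N.prob_space by simp
  finally have ga: "(\<Sum>i\<in>A. g i * a i) \<le> (\<integral>x. ?v x \<partial>N) + (\<epsilon> * D + \<epsilon>\<^sup>2 / 2 + \<eta> * ln (card B))" .
  have "\<alpha> * (\<integral>x. ?v x \<partial>N) \<le> H + ln (\<integral>x. exp (\<alpha> * ?v x) \<partial>M)"
    using entropy_inequality[OF \<rho> N[unfolded N_def] expv, folded N_def, OF _ ent] vN
    by (simp add: H_def)
  then have "(\<integral>x. ?v x \<partial>N) \<le> (H + ln (\<integral>x. exp (\<alpha> * ?v x) \<partial>M)) / \<alpha>"
    using \<alpha>_pos by (simp add: pos_le_divide_eq mult.commute)
  then have v_ent: "(\<integral>x. ?v x \<partial>N) \<le> H / \<alpha> + ln (\<integral>x. exp (\<alpha> * ?v x) \<partial>M) / \<alpha>"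
    by (simp add: add_divide_distrib)
  \<comment> \<open>Initial time s = \<epsilon> and potential bound C = D^2 / 2; the last smallness
    assumption on \<epsilon> is then the condition \<alpha> s C \<le> 1/2.\<close>
  have hj: "ln (\<integral>x. exp (\<alpha> * ?v x) \<partial>M) / \<alpha>
      \<le> (\<integral>x. f (t x) \<partial>M) + 2 * \<alpha> * \<epsilon> * (D\<^sup>2 / 2)\<^sup>2 + \<epsilon>\<^sup>2 / (2 * \<epsilon>)"
  proof (rule hopf_lax_exp_bound[OF fin(2) neB \<eta> yD f tM _ \<epsilon>])
    show "AE x in M. t x \<in> B \<and> dist x (y (t x)) \<le> \<epsilon>"
      using AE_K AEM by eventually_elim (use tK in simp)
  qed
  have \<epsilon>2: "\<epsilon>\<^sup>2 \<le> \<epsilon>" using \<epsilon> by (simp add: power2_eq_square mult_le_one)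
  \<comment> \<open>The 3 collects the duality gap (1), the smoothing loss (1), half from
    \<epsilon>^2 / 2 \<le> \<epsilon> / 2 and half from \<epsilon>^2 / (2 s) at s =
    \<epsilon>.\<close>
  have wc: "(\<Sum>i\<in>A. \<Sum>j\<in>B. w i j * c i j) \<le> H / \<alpha> + \<epsilon> * (\<alpha> * D ^ 4 / 2 + D + 3)"
  proof -
    have "2 * \<alpha> * \<epsilon> * (D\<^sup>2 / 2)\<^sup>2 = \<epsilon> * (\<alpha> * D ^ 4 / 2)"
      by (simp add: power_divide power_mult[symmetric])
    moreover have "\<epsilon>\<^sup>2 / (2 * \<epsilon>) = \<epsilon> / 2" using \<epsilon> by (simp add: power2_eq_square)
    moreover have "\<epsilon> * (\<alpha> * D ^ 4 / 2 + D + 3) = \<epsilon> * (\<alpha> * D ^ 4 / 2) + \<epsilon> * D + 3 * \<epsilon>"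
      by (simp add: distrib_left)
    ultimately show ?thesis
      using dual ga v_ent hj \<eta>_ln \<epsilon>2 unfolding Mint by linarith
  qed
  obtain \<pi> where \<pi>: "\<pi> \<in> couplings N M"
    and \<pi>_int: "\<And>G. (\<integral>\<^sup>+z. G (t (fst z)) (t (snd z)) \<partial>\<pi>) = (\<Sum>i\<in>A. \<Sum>j\<in>B. ennreal (w i j) * G i j)"
    by (rule coupling_of_discrete_plan[OF N prob_space_axioms setsN sets_eq t fin AEN AEM a_def[symmetric] apos b_def[symmetric] bpos w]) blast+
  have \<pi>_fst: "distr \<pi> borel fst = N" and \<pi>_snd: "distr \<pi> borel snd = M" and \<pi>_sets: "sets \<pi> = sets (borel \<Otimes>\<^sub>M borel)"
    using \<pi> by (simp_all add: couplings_def)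
  have mf: "fst \<in> measurable \<pi> borel" "snd \<in> measurable \<pi> borel"
    by (simp_all add: measurable_cong_sets[OF \<pi>_sets refl])
  have K1: "AE z in \<pi>. fst z \<in> K"
    by (rule AE_distrD[OF mf(1)]) (simp only: \<pi>_fst AE_KN)
  have K2: "AE z in \<pi>. snd z \<in> K"
    by (rule AE_distrD[OF mf(2)]) (simp only: \<pi>_snd AE_K)
  \<comment> \<open>Both points move to their centres, so the distance grows by at most 2 \<epsilon>
    and its square by at most 4 \<epsilon> D + 4 \<epsilon>^2.\<close>
  have "(\<integral>\<^sup>+z. ennreal ((dist (fst z) (snd z))\<^sup>2) \<partial>\<pi>)
      \<le> (\<integral>\<^sup>+z. ennreal (2 * c (t (fst z)) (t (snd z)) + \<epsilon> * (4 * D + 4)) \<partial>\<pi>)"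
  proof (rule nn_integral_mono_AE)
    show "AE z in \<pi>. ennreal ((dist (fst z) (snd z))\<^sup>2) \<le> ennreal (2 * c (t (fst z)) (t (snd z)) + \<epsilon> * (4 * D + 4))"
      using K1 K2
    proof eventually_elim
      case (elim z)
      let ?d = "dist (y (t (fst z))) (y (t (snd z)))"
      have "dist (fst z) (snd z) \<le> ?d + 2 * \<epsilon>"
        using tK[OF elim(1)] tK[OF elim(2)] dist_triangle[of "fst z" "snd z" "y (t (fst z))"]
          dist_triangle[of "y (t (fst z))" "snd z" "y (t (snd z))"] by (simp add: dist_commute)
      then have "(dist (fst z) (snd z))\<^sup>2 \<le> (?d + 2 * \<epsilon>)\<^sup>2" by (intro power_mono) auto
      also have "\<dots> = ?d\<^sup>2 + 4 * (\<epsilon> * ?d) + 4 * \<epsilon>\<^sup>2"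
        by (simp add: power2_sum power_mult_distrib)
      also have "\<epsilon> * ?d \<le> \<epsilon> * D"
        using D(2)[OF yK yK, of "t (fst z)" "t (snd z)"] tK elim \<epsilon>(1) by simp
      finally have "(dist (fst z) (snd z))\<^sup>2 \<le> 2 * c (t (fst z)) (t (snd z)) + \<epsilon> * (4 * D + 4)"
        using \<epsilon>2 by (simp add: c_def distrib_left)
      then show ?case by (rule ennreal_leI)
    qed
  qed
  also have "\<dots> = (\<Sum>i\<in>A. \<Sum>j\<in>B. ennreal (w i j) * ennreal (2 * c i j + \<epsilon> * (4 * D + 4)))"
    by (rule \<pi>_int)
  also have "\<dots> = (\<Sum>i\<in>A. \<Sum>j\<in>B. ennreal (w i j * (2 * c i j + \<epsilon> * (4 * D + 4))))"
    using w(1) by (intro sum.cong refl) (simp add: ennreal_mult')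
  also have "\<dots> = ennreal (\<Sum>i\<in>A. \<Sum>j\<in>B. w i j * (2 * c i j + \<epsilon> * (4 * D + 4)))"
  proof -
    have nn: "0 \<le> w i j * (2 * c i j + \<epsilon> * (4 * D + 4))" if "i \<in> A" "j \<in> B" for i j
      using w(1)[OF that] c[OF that] \<epsilon>(1) D(1) by simp
    then show ?thesis by (simp add: sum_ennreal sum_nonneg)
  qed
  also have "(\<Sum>i\<in>A. \<Sum>j\<in>B. w i j * (2 * c i j + \<epsilon> * (4 * D + 4)))
      = 2 * (\<Sum>i\<in>A. \<Sum>j\<in>B. w i j * c i j) + \<epsilon> * (4 * D + 4)"
  proof -
    have "(\<Sum>i\<in>A. \<Sum>j\<in>B. w i j * (2 * c i j + \<epsilon> * (4 * D + 4)))
      = (\<Sum>i\<in>A. \<Sum>j\<in>B. 2 * (w i j * c i j)) + (\<Sum>i\<in>A. (\<Sum>j\<in>B. w i j) * (\<epsilon> * (4 * D + 4)))"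
      unfolding sum_distrib_right sum.distrib[symmetric] by (simp add: distrib_left mult.left_commute)
    also have "(\<Sum>i\<in>A. (\<Sum>j\<in>B. w i j) * (\<epsilon> * (4 * D + 4))) = \<epsilon> * (4 * D + 4)"
      using w(2) one(1) by (simp add: sum_distrib_right[symmetric])
    finally show ?thesis by (simp only: sum_distrib_left)
  qed
  also have "ennreal (2 * (\<Sum>i\<in>A. \<Sum>j\<in>B. w i j * c i j) + \<epsilon> * (4 * D + 4))
      \<le> ennreal (2 / \<alpha> * H + \<epsilon> * (\<alpha> * D ^ 4 + 6 * D + 12))"
  proof (rule ennreal_leI)
    have "2 / \<alpha> * H = 2 * (H / \<alpha>)" by simp
    moreover have "\<epsilon> * (\<alpha> * D ^ 4 + 6 * D + 12)
        = 2 * (\<epsilon> * (\<alpha> * D ^ 4 / 2 + D + 3)) + \<epsilon> * (4 * D + 4) + 2 * \<epsilon>"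
      by (simp add: algebra_simps)
    ultimately show "2 * (\<Sum>i\<in>A. \<Sum>j\<in>B. w i j * c i j) + \<epsilon> * (4 * D + 4)
      \<le> 2 / \<alpha> * H + \<epsilon> * (\<alpha> * D ^ 4 + 6 * D + 12)"
      using wc \<epsilon>(1) by linarith
  qed
  finally show ?thesis using \<pi> by (auto simp: H_def)
qed

end

lemma W2_le_coupling:
  assumes "\<pi> \<in> couplings \<mu>0 \<mu>1"
  shows "(W2 \<mu>0 \<mu>1)\<^sup>2 \<le> (\<integral>\<^sup>+z. ennreal ((dist (fst z) (snd z))\<^sup>2) \<partial>\<pi>)"
proof -
  define I where "I = (\<integral>\<^sup>+z. ennreal ((dist (fst z) (snd z))\<^sup>2) \<partial>\<pi>)"
  have "W2 \<mu>0 \<mu>1 \<le> ennreal_sqrt I"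
    unfolding W2_def I_def using assms by (rule INF_lower)
  then have "(W2 \<mu>0 \<mu>1)\<^sup>2 \<le> (ennreal_sqrt I)\<^sup>2"
    by (intro power_mono) auto
  also have "\<dots> = I"
  proof (cases "I = \<infinity>")
    case False
    then show ?thesis
      by (cases I) (auto simp: ennreal_sqrt_def ennreal_power)
  qed (simp add: ennreal_sqrt_def)
  finally show ?thesis by (simp add: I_def)
qed

text \<open>The error factor depends only on \<alpha> and the diameter bound for K, so \<epsilon>
  can be sent to 0. Nonnegativity of the entropy, the case h = 0 of the entropy inequality, is
  recorded because \<open>ennreal\<close> clips negative numbers.\<close>

lemma (in log_sobolev_space) transport_entropy_inequality:
  fixes \<rho> :: "'a \<Rightarrow> real"
  defines "N \<equiv> density M (\<lambda>x. ennreal (\<rho> x))"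
  assumes \<rho>: "\<rho> \<in> borel_measurable M" "\<And>x. 0 \<le> \<rho> x" and N: "prob_space N"
    and ent: "integrable N (\<lambda>x. ln (\<rho> x))"
  shows "0 \<le> (\<integral>x. ln (\<rho> x) \<partial>N)" "(W2 N M)\<^sup>2 \<le> ennreal (2 / \<alpha> * (\<integral>x. ln (\<rho> x) \<partial>N))"
proof -
  define H where "H = (\<integral>x. ln (\<rho> x) \<partial>N)"
  show H: "0 \<le> (\<integral>x. ln (\<rho> x) \<partial>N)"
    using entropy_inequality[OF \<rho> N[unfolded N_def], of "\<lambda>_. 0", folded N_def] ent prob_space by simp
  obtain D where D: "0 < D" "\<And>x y. x \<in> K \<Longrightarrow> y \<in> K \<Longrightarrow> dist x y < D"
    using compact_imp_bounded[OF compact_K] unfolding bounded_two_points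
    by (metis dual_order.strict_trans2 gt_ex linorder_not_le max_less_iff_conj not_less_iff_gr_or_eq)
  define L where "L = \<alpha> * D ^ 4 + 6 * D + 12"
  have L: "0 < L" using D(1) \<alpha>_pos by (simp add: L_def add_pos_pos)
  show "(W2 N M)\<^sup>2 \<le> ennreal (2 / \<alpha> * (\<integral>x. ln (\<rho> x) \<partial>N))"
  proof (rule ennreal_le_epsilon)
    fix e :: real assume e: "0 < e"
    \<comment> \<open>The three bounds give \<epsilon> \<le> 1, total error at most
      \<open>e\<close>, and \<alpha> \<epsilon> D^2 / 2 \<le> 1/2.\<close>
    define \<epsilon> where "\<epsilon> = min (min 1 (e / L)) (1 / (\<alpha> * D\<^sup>2))"
    have aD: "0 < \<alpha> * D\<^sup>2" using D(1) \<alpha>_pos by simp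
    have \<epsilon>: "0 < \<epsilon>" "\<epsilon> \<le> 1" using e L aD by (auto simp: \<epsilon>_def)
    have "\<epsilon> \<le> e / L" by (simp add: \<epsilon>_def)
    then have \<epsilon>L: "\<epsilon> * L \<le> e" using L by (simp add: pos_le_divide_eq)
    have "\<epsilon> \<le> 1 / (\<alpha> * D\<^sup>2)" by (simp add: \<epsilon>_def)
    then have "\<epsilon> * (\<alpha> * D\<^sup>2) \<le> 1" using aD by (simp only: pos_le_divide_eq)
    then have "\<alpha> * \<epsilon> * (D\<^sup>2 / 2) \<le> 1 / 2" by (simp add: mult_ac)
    then obtain \<pi> where \<pi>: "\<pi> \<in> couplings N M"
      "(\<integral>\<^sup>+z. ennreal ((dist (fst z) (snd z))\<^sup>2) \<partial>\<pi>) \<le> ennreal (2 / \<alpha> * H + \<epsilon> * L)"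
      using near_optimal_coupling[OF \<rho> N[unfolded N_def], of D \<epsilon>, folded N_def, OF ent] D \<epsilon>
      unfolding H_def L_def by (meson less_imp_le)
    note W2_le_coupling[OF \<pi>(1)]
    also note \<pi>(2)
    also have "ennreal (2 / \<alpha> * H + \<epsilon> * L) \<le> ennreal (2 / \<alpha> * H + e)"
      using \<epsilon>L by (intro ennreal_leI) simp
    also have "\<dots> = ennreal (2 / \<alpha> * H) + ennreal e"
      using H \<alpha>_pos e by (intro ennreal_plus) (auto simp: H_def)
    finally show "(W2 N M)\<^sup>2 \<le> ennreal (2 / \<alpha> * (\<integral>x. ln (\<rho> x) \<partial>N)) + ennreal e"
      by (simp add: H_def)
  qed
qed

section \<open>The support of the Gibbs measure\<close>

lemma circle_eq_density: "circle = density lborel (\<lambda>x. ennreal (indicator {0..<2 * pi} x / (2 * pi)))"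
  unfolding circle_def uniform_measure_def
  by (intro arg_cong2[where f=density] ext refl)
    (auto simp: indicator_def divide_ennreal[symmetric] ennreal_1[symmetric] simp del: ennreal_1)

lemma integral_circle_FTC:
  fixes f F :: "real \<Rightarrow> real"
  assumes F: "\<And>x. (F has_real_derivative f x) (at x)" and f: "continuous_on UNIV f"
  shows "(LINT x|circle. f x) = (F (2 * pi) - F 0) / (2 * pi)"
proof -
  have [measurable]: "f \<in> borel_measurable borel" using f by (rule borel_measurable_continuous_onI)
  have "(LINT x|circle. f x) = (LINT x|lborel. indicator {0..<2 * pi} x / (2 * pi) * f x)"
    unfolding circle_eq_density by (subst integral_density) auto
  also have "\<dots> = (LINT x|lborel. (f x * indicator {0..2 * pi} x) / (2 * pi))"
  proof (rule integral_cong_AE)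
    have "AE x in lborel. x \<noteq> 2 * pi" by (rule AE_lborel_singleton)
    then show "AE x in lborel. indicator {0..<2 * pi} x / (2 * pi) * f x = f x * indicator {0..2 * pi} x / (2 * pi)"
      by eventually_elim (auto simp: indicator_def)
  qed auto
  also have "\<dots> = (F (2 * pi) - F 0) / (2 * pi)"
    using integral_FTC_Icc_real[of 0 "2 * pi" F f] F f by (simp add: continuous_on_eq_continuous_at)
  finally show ?thesis .
qed

lemma integral_circle_cos: "(LINT x|circle. cos (of_int n * x)) = (if n = 0 then 1 else 0)"
proof (cases "n = 0")
  case False
  have "(LINT x|circle. cos (of_int n * x)) = (sin (of_int n * (2 * pi)) / of_int n - sin (of_int n * 0) / of_int n) / (2 * pi)"
    by (rule integral_circle_FTC) (use False in \<open>auto intro!: derivative_eq_intros continuous_intros\<close>)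
  also have "sin (of_int n * (2 * pi)) = 0"
    using sin_int_2pin[of n] by (simp add: mult.commute)
  finally show ?thesis using False by simp
qed (simp add: circle.prob_space[simplified])

lemma integral_circle_sin: "(LINT x|circle. sin (of_int n * x)) = 0"
proof (cases "n = 0")
  case False
  have "(LINT x|circle. sin (of_int n * x)) = (- cos (of_int n * (2 * pi)) / of_int n - (- cos (of_int n * 0) / of_int n)) / (2 * pi)"
    by (rule integral_circle_FTC) (use False in \<open>auto intro!: derivative_eq_intros continuous_intros\<close>)
  also have "cos (of_int n * (2 * pi)) = 1"
    using cos_int_2pin[of n] by (simp add: mult.commute)
  finally show ?thesis by simp
qed simp

lemma square_integrable_bounded:
  assumes "f \<in> borel_measurable borel" "\<And>x. \<bar>f x\<bar> \<le> 1"
  shows "square_integrable f"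
proof -
  have "integrable circle (\<lambda>x. (f x)\<^sup>2)"
  proof (rule circle.integrable_const_bound[where B=1])
    show "AE x in circle. norm ((f x)\<^sup>2) \<le> 1"
      using assms(2) by (auto simp: abs_square_le_1)
  qed (use assms(1) in auto)
  then show ?thesis using assms(1) by (simp add: square_integrable_def)
qed

lift_definition cos_L2 :: "nat \<Rightarrow> L2T" is "\<lambda>j x. cos (real j * x)"
  by (simp add: L2_rel_def square_integrable_bounded)

lift_definition sin_L2 :: "nat \<Rightarrow> L2T" is "\<lambda>j x. sin (real j * x)"
  by (simp add: L2_rel_def square_integrable_bounded)

text \<open>As a finite combination of fixed vectors, the map is visibly continuous in the
  coefficients, and these can be read off by inner products.\<close>

lemma trig_L2_eq: "trig_L2 M p = (\<Sum>j=1..M. fst (p j) *\<^sub>R cos_L2 j + snd (p j) *\<^sub>R sin_L2 j)"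
proof (induction M)
  case 0
  show ?case
    by simp (transfer, simp add: L2_rel_def square_integrable_zero trig_sum_def[abs_def])
next
  case (Suc M)
  have "trig_L2 (Suc M) p = trig_L2 M p + (fst (p (Suc M)) *\<^sub>R cos_L2 (Suc M) + snd (p (Suc M)) *\<^sub>R sin_L2 (Suc M))"
  proof transfer
    fix M and p :: "nat \<Rightarrow> real \<times> real"
    have eq: "trig_sum (Suc M) p = (\<lambda>x. trig_sum M p x + (fst (p (Suc M)) * cos (real (Suc M) * x) + snd (p (Suc M)) * sin (real (Suc M) * x)))"
      by (simp add: trig_sum_def fun_eq_iff)
    show "L2_rel (trig_sum (Suc M) p) (\<lambda>x. trig_sum M p x + (fst (p (Suc M)) * cos (real (Suc M) * x) + snd (p (Suc M)) * sin (real (Suc M) * x)))"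
      unfolding eq[symmetric] by (simp add: L2_rel_def square_integrable_trig_sum)
  qed
  then show ?case by (simp add: Suc.IH)
qed

text \<open>The diagonal value is 1/2 because the measure is normalised to dx / (2 pi). The
  frequencies are taken in \<open>int\<close>, where j - k is not truncated; j + k is nonzero as
  both are positive.\<close>

lemma inner_cos_cos: "j \<ge> 1 \<Longrightarrow> k \<ge> 1 \<Longrightarrow> inner (cos_L2 j) (cos_L2 k) = (if j = k then 1 / 2 else 0)"
proof transfer
  fix j k :: nat assume jk: "j \<ge> 1" "k \<ge> 1"
  have int: "integrable circle (\<lambda>x. cos (real_of_int n * x))" for n
    by (rule circle.integrable_const_bound[where B=1]) auto
  have "(LINT x|circle. cos (real j * x) * cos (real k * x))
      = (LINT x|circle. (cos (of_int (int j - int k) * x) + cos (of_int (int j + int k) * x)) / 2)"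
    by (simp add: cos_times_cos left_diff_distrib distrib_right)
  also have "\<dots> = (if j = k then 1 / 2 else 0)"
    using jk int[of "int j - int k"] int[of "int j + int k"] integral_circle_cos[of "int j - int k"] integral_circle_cos[of "int j + int k"]
    by (simp del: of_int_add of_int_diff)
  finally show "(LINT x|circle. cos (real j * x) * cos (real k * x)) = (if j = k then 1 / 2 else 0)" .
qed

lemma inner_sin_sin: "j \<ge> 1 \<Longrightarrow> k \<ge> 1 \<Longrightarrow> inner (sin_L2 j) (sin_L2 k) = (if j = k then 1 / 2 else 0)"
proof transfer
  fix j k :: nat assume jk: "j \<ge> 1" "k \<ge> 1"
  have int: "integrable circle (\<lambda>x. cos (real_of_int n * x))" for n
    by (rule circle.integrable_const_bound[where B=1]) auto
  have "(LINT x|circle. sin (real j * x) * sin (real k * x))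
      = (LINT x|circle. (cos (of_int (int j - int k) * x) - cos (of_int (int j + int k) * x)) / 2)"
    by (simp add: sin_times_sin left_diff_distrib distrib_right)
  also have "\<dots> = (if j = k then 1 / 2 else 0)"
    using jk int[of "int j - int k"] int[of "int j + int k"] integral_circle_cos[of "int j - int k"] integral_circle_cos[of "int j + int k"]
    by (simp del: of_int_add of_int_diff)
  finally show "(LINT x|circle. sin (real j * x) * sin (real k * x)) = (if j = k then 1 / 2 else 0)" .
qed

lemma inner_sin_cos: "inner (sin_L2 j) (cos_L2 k) = 0"
proof transfer
  fix j k :: nat
  have int: "integrable circle (\<lambda>x. sin (real_of_int n * x))" for n
    by (rule circle.integrable_const_bound[where B=1]) auto
  have "(LINT x|circle. sin (real j * x) * cos (real k * x))
      = (LINT x|circle. (sin (of_int (int j + int k) * x) + sin (of_int (int j - int k) * x)) / 2)"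
    by (simp add: sin_times_cos left_diff_distrib distrib_right)
  also have "\<dots> = 0"
    using int[of "int j - int k"] int[of "int j + int k"] integral_circle_sin[of "int j - int k"] integral_circle_sin[of "int j + int k"]
    by (simp del: of_int_add of_int_diff)
  finally show "(LINT x|circle. sin (real j * x) * cos (real k * x)) = 0" .
qed

text \<open>Pairing with a basis vector of norm at most 1 yields half the coefficient, and
  Cauchy--Schwarz does the rest. Hence a bounded set of trigonometric sums has bounded
  coefficients.\<close>

lemma trig_L2_coefficient_le:
  assumes k: "k \<in> {1..M}"
  shows "\<bar>fst (p k)\<bar> \<le> 2 * norm (trig_L2 M p)" "\<bar>snd (p k)\<bar> \<le> 2 * norm (trig_L2 M p)"
proof -
  have k1: "k \<ge> 1" using k by simp
  have "inner (trig_L2 M p) (cos_L2 k) = (\<Sum>j=1..M. if k = j then fst (p k) / 2 else 0)"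
    unfolding trig_L2_eq inner_sum_left
    by (intro sum.cong refl) (use k1 in \<open>auto simp: inner_add_left inner_cos_cos inner_sin_cos\<close>)
  then have c: "inner (trig_L2 M p) (cos_L2 k) = fst (p k) / 2" using k by simp
  have "inner (trig_L2 M p) (sin_L2 k) = (\<Sum>j=1..M. if k = j then snd (p k) / 2 else 0)"
    unfolding trig_L2_eq inner_sum_left
    by (intro sum.cong refl) (use k1 in \<open>auto simp: inner_add_left inner_sin_sin inner_sin_cos inner_commute[of "cos_L2 _"]\<close>)
  then have s: "inner (trig_L2 M p) (sin_L2 k) = snd (p k) / 2" using k by simp
  have n: "norm (cos_L2 k) \<le> 1" "norm (sin_L2 k) \<le> 1"
    using k1 by (simp_all add: norm_eq_sqrt_inner inner_cos_cos inner_sin_sin)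
  show "\<bar>fst (p k)\<bar> \<le> 2 * norm (trig_L2 M p)"
    using Cauchy_Schwarz_ineq2[of "trig_L2 M p" "cos_L2 k"] mult_left_mono[OF n(1), of "norm (trig_L2 M p)"] c by simp
  show "\<bar>snd (p k)\<bar> \<le> 2 * norm (trig_L2 M p)"
    using Cauchy_Schwarz_ineq2[of "trig_L2 M p" "sin_L2 k"] mult_left_mono[OF n(2), of "norm (trig_L2 M p)"] s by simp
qed

section \<open>Measurability and compactness of the space of trigonometric sums\<close>

lemma continuous_on_trig_L2: "continuous_on UNIV (trig_L2 M)"
  unfolding trig_L2_eq[abs_def] by (intro continuous_intros) auto

text \<open>Irrelevant coordinates may be set to 0, which allows compactness and measurability to be
  treated on total functions.\<close>

lemma trig_L2_restrict: "trig_L2 M (\<lambda>j. if j \<in> {1..M} then p j else 0) = trig_L2 M p"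
  unfolding trig_L2_eq by (intro sum.cong) auto

text \<open>The library proves sums of measurable functions measurable only in second countable spaces, a
  class to which \<open>L2T\<close> does not belong, so measurability is obtained from continuity on the whole
  coordinate space.\<close>

lemma measurable_trig_L2: "trig_L2 M \<in> measurable (coords M) borel"
proof -
  let ?r = "\<lambda>(p :: nat \<Rightarrow> real \<times> real) j. if j \<in> {1..M} then p j else 0"
  have "?r \<in> measurable (coords M) (\<Pi>\<^sub>M j\<in>UNIV. borel)"
  proof (rule measurable_PiM_single')
    fix i :: nat
    show "(\<lambda>p. ?r p i) \<in> measurable (coords M) borel"
    proof (cases "i \<in> {1..M}")
      case True
      then have "(\<lambda>p. p i) \<in> measurable (coords M) lborel"
        unfolding coords_def by (rule measurable_component_singleton)
      then show ?thesis using True by simp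
    next
      case False
      then have "(\<lambda>p. ?r p i) = (\<lambda>p. 0)" by auto
      then show ?thesis by (simp only: borel_measurable_const)
    qed
  qed auto
  then have "?r \<in> measurable (coords M) borel"
    using measurable_cong_sets[OF refl sets_PiM_equal_borel] by blast
  moreover have "trig_L2 M \<in> measurable borel borel"
    using continuous_on_trig_L2 by (rule borel_measurable_continuous_onI)
  ultimately have "(\<lambda>p. trig_L2 M (?r p)) \<in> measurable (coords M) borel"
    by (rule measurable_compose)
  then show ?thesis by (simp only: trig_L2_restrict)
qed

lemma closed_Omega: "closed (Omega N)"
  unfolding Omega_def by (intro closed_Collect_le continuous_intros)

text \<open>Within the ball the coefficients of modes 1 to M stay in a square of half-width 2 sqrt
  N, so the set is the image of a compact cube cut by a closed ball. For negative N the ball is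
  empty.\<close>

lemma compact_trig_Omega: "compact (range (trig_L2 M) \<inter> Omega N)"
proof (cases "N \<ge> 0")
  case True
  define R where "R = 2 * sqrt N"
  define P where "P = {p :: nat \<Rightarrow> real \<times> real. \<forall>j. p j \<in> (if j \<in> {1..M} then {-R..R} \<times> {-R..R} else {0})}"
  have "compact P"
    unfolding P_def by (rule compact_Pi_UNIV) (auto intro: compact_Times)
  then have "compact (trig_L2 M ` P)"
    by (rule compact_continuous_image[OF continuous_on_subset[OF continuous_on_trig_L2 subset_UNIV]])
  then have "compact (trig_L2 M ` P \<inter> Omega N)"
    by (rule compact_Int_closed[OF _ closed_Omega])
  moreover have "range (trig_L2 M) \<inter> Omega N = trig_L2 M ` P \<inter> Omega N"
  proof (intro equalityI subsetI)
    fix f assume f: "f \<in> range (trig_L2 M) \<inter> Omega N"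
    then obtain p where p: "f = trig_L2 M p" by auto
    have "norm f \<le> sqrt N"
      using f by (intro real_le_rsqrt) (simp add: Omega_def)
    then have bd: "\<bar>fst (p j)\<bar> \<le> R" "\<bar>snd (p j)\<bar> \<le> R" if "j \<in> {1..M}" for j
      using trig_L2_coefficient_le[OF that, of p] p by (auto simp: R_def)
    have "p j \<in> {-R..R} \<times> {-R..R}" if "j \<in> {1..M}" for j
      using bd[OF that] unfolding mem_Times_iff atLeastAtMost_iff by linarith
    then have "(\<lambda>j. if j \<in> {1..M} then p j else 0) \<in> P"
      by (simp add: P_def del: atLeastAtMost_iff)
    then have "trig_L2 M (\<lambda>j. if j \<in> {1..M} then p j else 0) \<in> trig_L2 M ` P"
      by (rule imageI)
    then have "f \<in> trig_L2 M ` P"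
      by (simp only: trig_L2_restrict p)
    then show "f \<in> trig_L2 M ` P \<inter> Omega N"
      using f by blast
  qed auto
  ultimately show ?thesis by simp
next
  case False
  then have "Omega N = {}" by (auto simp: Omega_def) (smt (verit) zero_le_power2)
  then show ?thesis by simp
qed

section \<open>The Gibbs measure as an instance of the abstract setting\<close>

lemma gibbs_weight_nonneg: "0 \<le> gibbs_weight \<beta> N M p"
  unfolding gibbs_weight_def by (intro mult_nonneg_nonneg prod_nonneg divide_nonneg_nonneg) auto

lemma sets_gibbs [simp]: "sets (gibbs \<beta> N M) = sets borel"
  by (simp add: gibbs_def)

text \<open>If the weight is not integrable or has integral \<open>0\<close>, then \<open>gibbs_Z = 0\<close> and, since
  \<open>x / 0 = 0\<close>, the Gibbs measure is the null measure.\<close>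

lemma emeasure_gibbs_of_Z_eq_0:
  assumes "gibbs_Z \<beta> N M = 0"
  shows "emeasure (gibbs \<beta> N M) UNIV = 0"
proof -
  have "gibbs \<beta> N M = distr (density (coords M) (\<lambda>p. 0)) borel (trig_L2 M)"
    by (simp add: gibbs_def assms)
  then show ?thesis
    using measurable_trig_L2 by (simp add: emeasure_distr emeasure_density)
qed

lemma
  assumes Z: "gibbs_Z \<beta> N M \<noteq> 0"
  shows prob_space_gibbs: "prob_space (gibbs \<beta> N M)"
    and AE_gibbs: "AE f in gibbs \<beta> N M. f \<in> range (trig_L2 M) \<inter> Omega N"
proof -
  let ?w = "gibbs_weight \<beta> N M" and ?Z = "gibbs_Z \<beta> N M"
  \<comment> \<open>A Bochner integral with nonzero value belongs to an integrable function.\<close>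
  have int: "integrable (coords M) ?w"
    using Z not_integrable_integral_eq unfolding gibbs_Z_def by blast
  have Z_pos: "0 < ?Z"
    using Z Bochner_Integration.integral_nonneg[of "coords M" ?w] gibbs_weight_nonneg unfolding gibbs_Z_def by (simp add: less_le)
  have meas: "(\<lambda>p. ennreal (?w p / ?Z)) \<in> borel_measurable (coords M)"
    using int by auto
  have trig: "trig_L2 M \<in> measurable (density (coords M) (\<lambda>p. ennreal (?w p / ?Z))) borel"
    using measurable_trig_L2 by simp
  have "emeasure (gibbs \<beta> N M) UNIV = (\<integral>\<^sup>+p. ennreal (?w p / ?Z) \<partial>coords M)"
    unfolding gibbs_def by (subst emeasure_distr[OF trig]) (auto simp: emeasure_density meas intro!: nn_integral_cong)
  also have "\<dots> = ennreal (LINT p|coords M. ?w p / ?Z)"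
    using int Z_pos gibbs_weight_nonneg by (intro nn_integral_eq_integral) auto
  also have "(LINT p|coords M. ?w p / ?Z) = 1"
    using Z by (simp add: gibbs_Z_def)
  finally show "prob_space (gibbs \<beta> N M)"
    by (intro prob_spaceI) (simp add: gibbs_def)
  have "range (trig_L2 M) \<inter> Omega N \<in> sets borel"
    by (intro borel_closed compact_imp_closed compact_trig_Omega)
  then have "{f \<in> space borel. f \<in> range (trig_L2 M) \<inter> Omega N} \<in> sets borel"
    by (simp only: space_borel UNIV_I simp_thms Collect_mem_eq)
  then show "AE f in gibbs \<beta> N M. f \<in> range (trig_L2 M) \<inter> Omega N"
    unfolding gibbs_def
    by (subst AE_distr_iff[OF trig], assumption, subst AE_density[OF meas])
      (auto simp: gibbs_weight_def indicator_def split: if_splits)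
qed

text \<open>A C^1 function on the whole space is C^1 relative to the ball with the same derivative,
  and integrals over the ball are full integrals because its complement is null.\<close>

lemma log_sobolev_space_gibbs:
  assumes Z: "gibbs_Z \<beta> N M \<noteq> 0" and \<alpha>: "\<alpha> > 0" and ls: "log_sobolev \<beta> N M \<alpha>"
  shows "log_sobolev_space (gibbs \<beta> N M) (range (trig_L2 M) \<inter> Omega N) \<alpha>"
proof -
  interpret prob_space "gibbs \<beta> N M" by (rule prob_space_gibbs[OF Z])
  have AE_Omega: "AE f in gibbs \<beta> N M. f \<in> Omega N"
    using AE_gibbs[OF Z] by eventually_elim simp
  have Omega: "Omega N \<in> sets borel" using closed_Omega by (rule borel_closed)
  have set_eq: "(LINT f:Omega N|gibbs \<beta> N M. h f) = (LINT f|gibbs \<beta> N M. h f)"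
    if h: "h \<in> borel_measurable borel" for h :: "L2T \<Rightarrow> real"
    unfolding set_lebesgue_integral_def
  proof (rule integral_cong_AE)
    show "AE f in gibbs \<beta> N M. indicator (Omega N) f *\<^sub>R h f = h f"
      using AE_Omega by eventually_elim simp
  qed (use h Omega in \<open>simp_all add: measurable_cong_sets[OF sets_gibbs refl]\<close>)
  show ?thesis
  proof (unfold_locales)
    show "compact (range (trig_L2 M) \<inter> Omega N)" by (rule compact_trig_Omega)
    show "AE f in gibbs \<beta> N M. f \<in> range (trig_L2 M) \<inter> Omega N" by (rule AE_gibbs[OF Z])
    fix F :: "L2T \<Rightarrow> real" and F' :: "L2T \<Rightarrow> L2T \<Rightarrow>\<^sub>L real"
    assume F: "\<And>x. (F has_derivative blinfun_apply (F' x)) (at x)" and F': "continuous_on UNIV F'"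
    have "C1_on_Omega N F F'"
      unfolding C1_on_Omega_def using F F' by (auto intro: has_derivative_at_withinI continuous_on_subset)
    note le = ls[unfolded log_sobolev_def, rule_format, OF this]
    have "continuous_on UNIV F"
      using F by (meson has_derivative_continuous continuous_at_imp_continuous_on)
    then have [measurable]: "F \<in> borel_measurable borel" by (rule borel_measurable_continuous_onI)
    have [measurable]: "(\<lambda>x. norm (F' x)) \<in> borel_measurable borel"
      using F' by (intro borel_measurable_continuous_onI continuous_on_norm)
    show "(LINT x|gibbs \<beta> N M. (F x)\<^sup>2 * ln ((F x)\<^sup>2 / (LINT y|gibbs \<beta> N M. (F y)\<^sup>2)))
        \<le> 2 / \<alpha> * (LINT x|gibbs \<beta> N M. (norm (F' x))\<^sup>2)"
      using le by (simp add: set_eq)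
  qed (use \<alpha> in auto)
qed

theorem proposition4p4:
  fixes c \<beta> N \<alpha> :: real and M :: nat and \<nu> :: "L2T measure"
  assumes "c > 0" and "\<beta> > 0" and "N > 0"
    and "\<alpha> \<ge> 1 / 2 * exp (- 14 * \<beta> * N powr (3 / 2) * (c * N * \<beta> powr (1 / 2) + 1) - N / 2)"
    and "log_sobolev \<beta> N M \<alpha>"
    and "prob_space \<nu>" and "sets \<nu> = sets borel" and "emeasure \<nu> (Omega N) = 1"
    and "absolutely_continuous (gibbs \<beta> N M) \<nu>"
  shows "enn2ereal ((W2 \<nu> (gibbs \<beta> N M))\<^sup>2)
    \<le> ereal (2 / \<alpha>)
      * extended_integral \<nu> (Omega N) (\<lambda>f. ln (enn2real (RN_deriv (gibbs \<beta> N M) \<nu> f)))"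
proof -
  let ?\<mu> = "gibbs \<beta> N M"
  interpret \<nu>: prob_space \<nu> by fact
  \<comment> \<open>The lower bound for \<alpha> is half an exponential, hence positive.\<close>
  have \<alpha>: "\<alpha> > 0" using assms(4) by (rule less_le_trans[rotated]) simp
  have sp: "space \<nu> = UNIV" using sets_eq_imp_space_eq[OF assms(7)] by simp
  \<comment> \<open>Absolute continuity excludes the degenerate case: with respect to the null
    measure it would make the probability measure \<nu> null.\<close>
  have "gibbs_Z \<beta> N M \<noteq> 0"
  proof
    assume "gibbs_Z \<beta> N M = 0"
    then have "UNIV \<in> null_sets ?\<mu>"
      by (intro null_setsI) (auto simp: emeasure_gibbs_of_Z_eq_0)
    then have "UNIV \<in> null_sets \<nu>"
      using assms(9) by (auto simp: absolutely_continuous_def)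
    then show False using \<nu>.emeasure_space_1 sp by (simp add: null_sets_def)
  qed
  then interpret \<mu>: log_sobolev_space ?\<mu> "range (trig_L2 M) \<inter> Omega N" \<alpha>
    by (rule log_sobolev_space_gibbs[OF _ \<alpha> assms(5)])
  define \<rho> where "\<rho> f = enn2real (RN_deriv ?\<mu> \<nu> f)" for f
  have \<rho>: "\<rho> \<in> borel_measurable ?\<mu>" "\<And>f. 0 \<le> \<rho> f"
    by (simp_all add: \<rho>_def[abs_def])
  have sets: "sets \<nu> = sets ?\<mu>" using assms(7) by simp
  \<comment> \<open>\<open>enn2real\<close> sends \<infinity> to 0, but the Radon--Nikodym
    derivative is infinite only on a null set, so \<rho> is still a density of \<nu>.\<close>
  have "AE f in ?\<mu>. RN_deriv ?\<mu> \<nu> f \<noteq> \<infinity>"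
    by (rule \<mu>.RN_deriv_finite[OF \<nu>.sigma_finite_measure_axioms assms(9) sets])
  then have "density ?\<mu> (\<lambda>f. ennreal (\<rho> f)) = density ?\<mu> (RN_deriv ?\<mu> \<nu>)"
    by (intro density_cong) (auto simp: \<rho>_def elim!: eventually_mono intro: ennreal_enn2real simp: less_top)
  then have \<nu>_eq: "density ?\<mu> (\<lambda>f. ennreal (\<rho> f)) = \<nu>"
    using \<mu>.density_RN_deriv[OF assms(9) sets] by simp
  have prob: "prob_space (density ?\<mu> (\<lambda>f. ennreal (\<rho> f)))" by (simp add: \<nu>_eq assms(6))
  have "AE f in \<nu>. f \<in> Omega N"
    using closed_Omega[of N] assms(7,8) by (intro \<nu>.AE_prob_1) (simp add: measure_def)
  then consider "extended_integral \<nu> (Omega N) (\<lambda>f. ln (\<rho> f)) = \<infinity>"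
    | "integrable \<nu> (\<lambda>f. ln (\<rho> f))" "extended_integral \<nu> (Omega N) (\<lambda>f. ln (\<rho> f)) = ereal (\<integral>f. ln (\<rho> f) \<partial>\<nu>)"
    using extended_entropy_cases[OF \<mu>.prob_space_axioms \<rho>, of "Omega N"] unfolding \<nu>_eq by blast
  then have "enn2ereal ((W2 \<nu> ?\<mu>)\<^sup>2) \<le> ereal (2 / \<alpha>) * extended_integral \<nu> (Omega N) (\<lambda>f. ln (\<rho> f))"
  proof cases
    case 1
    \<comment> \<open>Since 2 / \<alpha> is positive, infinite entropy makes the right side
      infinite.\<close>
    then show ?thesis using \<alpha> by simp
  next
    case 2
    note te = \<mu>.transport_entropy_inequality[OF \<rho> prob, unfolded \<nu>_eq, OF 2(1)]
    have "enn2ereal ((W2 \<nu> ?\<mu>)\<^sup>2) \<le> enn2ereal (ennreal (2 / \<alpha> * (\<integral>f. ln (\<rho> f) \<partial>\<nu>)))"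
      using te(2) by (simp only: less_eq_ennreal.rep_eq)
    also have "\<dots> = ereal (2 / \<alpha> * (\<integral>f. ln (\<rho> f) \<partial>\<nu>))"
      using te(1) \<alpha> by (intro enn2ereal_ennreal) simp
    finally show ?thesis using 2(2) by simp
  qed
  then show ?thesis by (simp only: \<rho>_def)
qed

end
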